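(* Let $n\ge1$ and let a local shadow wave solution, with front $r=R+c(t)>0$ ($0\le t<T$), outer states $(\rho_0,u_0)$, $(\rho_1,u_1)$ and mass $\sigma(t)$, of the system $$\partial_t\rho+\partial_r(\rho u)+\tfrac{n-1}{r}\rho u=0,\qquad \partial_t(\rho u)+\partial_r(\rho u^2)+\tfrac{n-1}{r}\rho u^2=0$$ be given. It is dissipative if and only if, for all $t\in(0,T)$ and with all quantities evaluated at $r=R+c(t)$, $$\kappa_1\,(u_0u_1-\dot c^2)\le\kappa_2\,(u_0+u_1-2\dot c),$$ or equivalently, $$-\dot c^3[\rho]+3\dot c^2[\rho u]-3\dot c[\rho u^2]+[\rho u^3]\le0 .$$
   Context: Jump notation: $[f]=f_1-f_0$, where $f_0,f_1$ are formed from $(\rho_0,u_0)$, $(\rho_1,u_1)$ and evaluated at $(R+c(t),t)$. Set $\kappa_1=\dot c[\rho]-[\rho u]$ and $\kappa_2=\dot c[\rho u]-[\rho u^2]$. A local shadow wave solution on $[0,T)$ with front $r=R+c(t)>0$ ($R>0$, $c(0)=0$) is a family, indexed by $\varepsilon>0$, $$(\rho^\varepsilon_{sw},u^\varepsilon_{sw})=\begin{cases}(\rho_0,u_0)(r,t), & r-R<c(t)-\varepsilon/2,\\ (\sigma(t)/\varepsilon,\,v(t)), & c(t)-\varepsilon/2<r-R<c(t)+\varepsilon/2,\\ (\rho_1,u_1)(r,t), & r-R>c(t)+\varepsilon/2,\end{cases}$$ where $\sigma,v\in C^1([0,T))$, $(\rho_0,u_0)$ and $(\rho_1,u_1)$ are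 $C^1$ (up to the front) and solve the system in $\{0<r<R+c(t)\}$ and $\{r>R+c(t)\}$ respectively, $v\equiv\dot c$, and $$\partial_t\sigma+\tfrac{n-1}{R+c(t)}\sigma v=\kappa_1,\qquad \partial_t(\sigma v)+\tfrac{n-1}{R+c(t)}\sigma v^2=\kappa_2 .$$ It is called dissipative if $$\lim_{\varepsilon\to0}\Big(\partial_t\big(\tfrac12\rho^\varepsilon_{sw}(u^\varepsilon_{sw})^2\big)+\partial_r\big(\tfrac12\rho^\varepsilon_{sw}(u^\varepsilon_{sw})^3\big)+\tfrac{n-1}{2r}\rho^\varepsilon_{sw}(u^\varepsilon_{sw})^3\Big)\le0$$ in the sense of distributions, i.e. when applied to nonnegative test functions $\phi\in C_c^\infty(\,]0,\infty[\times]0,T[\,)$. *)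

theory Defs
  imports "HOL-Analysis.Analysis"
begin

text \<open>Functions on space-time take a pair \<open>(r, t)\<close>: radius first, time second.\<close>

subsection \<open>Regularity\<close>

text \<open>
  \<open>C\<^sup>1\<close> on a set that may contain part of its boundary: the derivative is taken within \<open>S\<close> and is
  continuous on all of \<open>S\<close>. (In finite dimension, continuity of all \<open>\<lambda>x. f' x h\<close> is continuity of
  \<open>f'\<close> in operator norm.)
\<close>

definition C1_on :: "'a::euclidean_space set \<Rightarrow> ('a \<Rightarrow> real) \<Rightarrow> bool" where
  "C1_on S f \<longleftrightarrow>
     (\<exists>f'. (\<forall>x\<in>S. (f has_derivative f' x) (at x within S)) \<and>
           (\<forall>h. continuous_on S (\<lambda>x. f' x h)))"

primrec Ck :: "nat \<Rightarrow> ('a::euclidean_space \<Rightarrow> real) \<Rightarrow> bool" where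
  "Ck 0 f \<longleftrightarrow> continuous_on UNIV f"
| "Ck (Suc k) f \<longleftrightarrow>
     (\<forall>x. f differentiable (at x)) \<and> (\<forall>h. Ck k (\<lambda>x. frechet_derivative f (at x) h))"

text \<open>
  \<open>C\<^sub>c\<^sup>\<infinity>(]0,\<infinity>[ \<times> ]0,T[)\<close>, each function being extended by zero to the whole plane.
\<close>

definition test_function :: "real \<Rightarrow> (real \<times> real \<Rightarrow> real) \<Rightarrow> bool" where
  "test_function T \<phi> \<longleftrightarrow>
     (\<forall>k. Ck k \<phi>) \<and>
     compact (closure {p. \<phi> p \<noteq> 0}) \<and>
     closure {p. \<phi> p \<noteq> 0} \<subseteq> {0<..} \<times> {0<..<T}"

subsection \<open>Derivatives and the system\<close>

definition d_r :: "(real \<times> real \<Rightarrow> real) \<Rightarrow> real \<times> real \<Rightarrow> real" where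
  "d_r f = (\<lambda>(r, t). deriv (\<lambda>r'. f (r', t)) r)"

definition d_t :: "(real \<times> real \<Rightarrow> real) \<Rightarrow> real \<times> real \<Rightarrow> real" where
  "d_t f = (\<lambda>(r, t). deriv (\<lambda>t'. f (r, t')) t)"

text \<open>Time derivative on \<open>[0,T[\<close>, one-sided at \<open>0\<close>.\<close>

definition ddt :: "real \<Rightarrow> (real \<Rightarrow> real) \<Rightarrow> real \<Rightarrow> real" where
  "ddt T f t = vector_derivative f (at t within {0..<T})"

text \<open>To be used on open \<open>\<Omega>\<close>, where \<^const>\<open>d_r\<close> and \<^const>\<open>d_t\<close> depend only on the values in \<open>\<Omega>\<close>.\<close>

definition solves_system ::
    "nat \<Rightarrow> (real \<times> real) set \<Rightarrow> (real \<times> real \<Rightarrow> real) \<Rightarrow> (real \<times> real \<Rightarrow> real) \<Rightarrow> bool" where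
  "solves_system n \<Omega> \<rho> u \<longleftrightarrow>
     (\<forall>(r, t)\<in>\<Omega>.
        d_t \<rho> (r, t) + d_r (\<lambda>p. \<rho> p * u p) (r, t)
          + (real n - 1) / r * \<rho> (r, t) * u (r, t) = 0 \<and>
        d_t (\<lambda>p. \<rho> p * u p) (r, t) + d_r (\<lambda>p. \<rho> p * (u p)\<^sup>2) (r, t)
          + (real n - 1) / r * \<rho> (r, t) * (u (r, t))\<^sup>2 = 0)"

subsection \<open>Jumps across the front\<close>

definition jump ::
    "real \<Rightarrow> (real \<Rightarrow> real) \<Rightarrow> (real \<times> real \<Rightarrow> real) \<Rightarrow> (real \<times> real \<Rightarrow> real) \<Rightarrow> real \<Rightarrow> real" where
  "jump R c f\<^sub>0 f\<^sub>1 t = f\<^sub>1 (R + c t, t) - f\<^sub>0 (R + c t, t)"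

text \<open>The jump of \<open>\<rho> u\<^sup>k\<close>.\<close>

definition jump_mom ::
    "real \<Rightarrow> (real \<Rightarrow> real) \<Rightarrow> (real \<times> real \<Rightarrow> real) \<Rightarrow> (real \<times> real \<Rightarrow> real) \<Rightarrow>
     (real \<times> real \<Rightarrow> real) \<Rightarrow> (real \<times> real \<Rightarrow> real) \<Rightarrow> nat \<Rightarrow> real \<Rightarrow> real" where
  "jump_mom R c \<rho>\<^sub>0 u\<^sub>0 \<rho>\<^sub>1 u\<^sub>1 k = jump R c (\<lambda>p. \<rho>\<^sub>0 p * u\<^sub>0 p ^ k) (\<lambda>p. \<rho>\<^sub>1 p * u\<^sub>1 p ^ k)"

definition kappa1 ::
    "real \<Rightarrow> real \<Rightarrow> (real \<Rightarrow> real) \<Rightarrow> (real \<times> real \<Rightarrow> real) \<Rightarrow> (real \<times> real \<Rightarrow> real) \<Rightarrow>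
     (real \<times> real \<Rightarrow> real) \<Rightarrow> (real \<times> real \<Rightarrow> real) \<Rightarrow> real \<Rightarrow> real" where
  "kappa1 R T c \<rho>\<^sub>0 u\<^sub>0 \<rho>\<^sub>1 u\<^sub>1 t =
     ddt T c t * jump_mom R c \<rho>\<^sub>0 u\<^sub>0 \<rho>\<^sub>1 u\<^sub>1 0 t - jump_mom R c \<rho>\<^sub>0 u\<^sub>0 \<rho>\<^sub>1 u\<^sub>1 1 t"

definition kappa2 ::
    "real \<Rightarrow> real \<Rightarrow> (real \<Rightarrow> real) \<Rightarrow> (real \<times> real \<Rightarrow> real) \<Rightarrow> (real \<times> real \<Rightarrow> real) \<Rightarrow>
     (real \<times> real \<Rightarrow> real) \<Rightarrow> (real \<times> real \<Rightarrow> real) \<Rightarrow> real \<Rightarrow> real" where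
  "kappa2 R T c \<rho>\<^sub>0 u\<^sub>0 \<rho>\<^sub>1 u\<^sub>1 t =
     ddt T c t * jump_mom R c \<rho>\<^sub>0 u\<^sub>0 \<rho>\<^sub>1 u\<^sub>1 1 t - jump_mom R c \<rho>\<^sub>0 u\<^sub>0 \<rho>\<^sub>1 u\<^sub>1 2 t"

subsection \<open>Local shadow wave solutions\<close>

text \<open>
  \<open>f\<^sub>0\<close> to the left of the strip of width \<open>\<epsilon>\<close> around the front, \<open>f\<^sub>1\<close> to its right, \<open>m\<close> inside.
  The two bounding curves are null sets; they are counted as part of the strip.
\<close>

definition three_state ::
    "real \<Rightarrow> (real \<Rightarrow> real) \<Rightarrow> (real \<times> real \<Rightarrow> real) \<Rightarrow> (real \<Rightarrow> real) \<Rightarrow>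
     (real \<times> real \<Rightarrow> real) \<Rightarrow> real \<Rightarrow> real \<times> real \<Rightarrow> real" where
  "three_state R c f\<^sub>0 m f\<^sub>1 \<epsilon> = (\<lambda>(r, t).
     if r - R < c t - \<epsilon> / 2 then f\<^sub>0 (r, t)
     else if r - R > c t + \<epsilon> / 2 then f\<^sub>1 (r, t)
     else m t)"

definition rho_sw ::
    "real \<Rightarrow> (real \<Rightarrow> real) \<Rightarrow> (real \<Rightarrow> real) \<Rightarrow> (real \<times> real \<Rightarrow> real) \<Rightarrow>
     (real \<times> real \<Rightarrow> real) \<Rightarrow> real \<Rightarrow> real \<times> real \<Rightarrow> real" where
  "rho_sw R c \<sigma> \<rho>\<^sub>0 \<rho>\<^sub>1 \<epsilon> = three_state R c \<rho>\<^sub>0 (\<lambda>t. \<sigma> t / \<epsilon>) \<rho>\<^sub>1 \<epsilon>"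

definition u_sw ::
    "real \<Rightarrow> (real \<Rightarrow> real) \<Rightarrow> (real \<Rightarrow> real) \<Rightarrow> (real \<times> real \<Rightarrow> real) \<Rightarrow>
     (real \<times> real \<Rightarrow> real) \<Rightarrow> real \<Rightarrow> real \<times> real \<Rightarrow> real" where
  "u_sw R c v u\<^sub>0 u\<^sub>1 \<epsilon> = three_state R c u\<^sub>0 v u\<^sub>1 \<epsilon>"

text \<open>
  The outer states are \<open>C\<^sup>1\<close> on the outer regions together with the front, for times in \<open>[0,T[\<close>.
  The system is imposed at interior points; at \<open>t = 0\<close> it then holds by continuity, with one-sided
  time derivatives.
\<close>

definition local_shadow_wave ::
    "nat \<Rightarrow> real \<Rightarrow> real \<Rightarrow> (real \<Rightarrow> real) \<Rightarrow> (real \<Rightarrow> real) \<Rightarrow> (real \<Rightarrow> real) \<Rightarrow>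
     (real \<times> real \<Rightarrow> real) \<Rightarrow> (real \<times> real \<Rightarrow> real) \<Rightarrow>
     (real \<times> real \<Rightarrow> real) \<Rightarrow> (real \<times> real \<Rightarrow> real) \<Rightarrow> bool" where
  "local_shadow_wave n R T c \<sigma> v \<rho>\<^sub>0 u\<^sub>0 \<rho>\<^sub>1 u\<^sub>1 \<longleftrightarrow>
     R > 0 \<and> T > 0 \<and> c 0 = 0 \<and> (\<forall>t\<in>{0..<T}. R + c t > 0) \<and>
     C1_on {0..<T} \<sigma> \<and> C1_on {0..<T} v \<and>
     (\<forall>t\<in>{0..<T}. (c has_real_derivative v t) (at t within {0..<T})) \<and>
     C1_on {(r, t). 0 \<le> t \<and> t < T \<and> 0 < r \<and> r \<le> R + c t} \<rho>\<^sub>0 \<and>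
     C1_on {(r, t). 0 \<le> t \<and> t < T \<and> 0 < r \<and> r \<le> R + c t} u\<^sub>0 \<and>
     C1_on {(r, t). 0 \<le> t \<and> t < T \<and> r \<ge> R + c t} \<rho>\<^sub>1 \<and>
     C1_on {(r, t). 0 \<le> t \<and> t < T \<and> r \<ge> R + c t} u\<^sub>1 \<and>
     solves_system n {(r, t). 0 < t \<and> t < T \<and> 0 < r \<and> r < R + c t} \<rho>\<^sub>0 u\<^sub>0 \<and>
     solves_system n {(r, t). 0 < t \<and> t < T \<and> r > R + c t} \<rho>\<^sub>1 u\<^sub>1 \<and>
     (\<forall>t\<in>{0..<T}.
        ddt T \<sigma> t + (real n - 1) / (R + c t) * \<sigma> t * v t
          = kappa1 R T c \<rho>\<^sub>0 u\<^sub>0 \<rho>\<^sub>1 u\<^sub>1 t \<and>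
        ddt T (\<lambda>s. \<sigma> s * v s) t + (real n - 1) / (R + c t) * \<sigma> t * (v t)\<^sup>2
          = kappa2 R T c \<rho>\<^sub>0 u\<^sub>0 \<rho>\<^sub>1 u\<^sub>1 t)"

subsection \<open>Dissipativity\<close>

text \<open>
  The distribution \<open>\<partial>\<^sub>t A + \<partial>\<^sub>r B + C\<close> on \<open>]0,\<infinity>[ \<times> ]0,T[\<close> applied to \<open>\<phi>\<close>, with respect to \<open>dr dt\<close>.
\<close>

definition balance_pairing ::
    "real \<Rightarrow> (real \<times> real \<Rightarrow> real) \<Rightarrow> (real \<times> real \<Rightarrow> real) \<Rightarrow> (real \<times> real \<Rightarrow> real) \<Rightarrow>
     (real \<times> real \<Rightarrow> real) \<Rightarrow> real" where
  "balance_pairing T A B C \<phi> =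
     (LINT p:{0<..} \<times> {0<..<T}|lborel. - A p * d_t \<phi> p - B p * d_r \<phi> p + C p * \<phi> p)"

definition energy_pairing ::
    "nat \<Rightarrow> real \<Rightarrow> (real \<times> real \<Rightarrow> real) \<Rightarrow> (real \<times> real \<Rightarrow> real) \<Rightarrow> (real \<times> real \<Rightarrow> real) \<Rightarrow> real" where
  "energy_pairing n T \<rho> u \<phi> =
     balance_pairing T
       (\<lambda>p. 1 / 2 * \<rho> p * (u p)\<^sup>2)
       (\<lambda>p. 1 / 2 * \<rho> p * (u p) ^ 3)
       (\<lambda>p. (real n - 1) / (2 * fst p) * \<rho> p * (u p) ^ 3) \<phi>"

definition dissipative ::
    "nat \<Rightarrow> real \<Rightarrow> real \<Rightarrow> (real \<Rightarrow> real) \<Rightarrow> (real \<Rightarrow> real) \<Rightarrow> (real \<Rightarrow> real) \<Rightarrow>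
     (real \<times> real \<Rightarrow> real) \<Rightarrow> (real \<times> real \<Rightarrow> real) \<Rightarrow>
     (real \<times> real \<Rightarrow> real) \<Rightarrow> (real \<times> real \<Rightarrow> real) \<Rightarrow> bool" where
  "dissipative n R T c \<sigma> v \<rho>\<^sub>0 u\<^sub>0 \<rho>\<^sub>1 u\<^sub>1 \<longleftrightarrow>
     (\<forall>\<phi>. test_function T \<phi> \<and> (\<forall>p. \<phi> p \<ge> 0) \<longrightarrow>
        (\<exists>L\<le>0. ((\<lambda>\<epsilon>. energy_pairing n T (rho_sw R c \<sigma> \<rho>\<^sub>0 \<rho>\<^sub>1 \<epsilon>) (u_sw R c v u\<^sub>0 u\<^sub>1 \<epsilon>) \<phi>)
                  \<longlongrightarrow> L) (at_right 0)))"

end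

theory Submission
  imports Defs "HOL-Computational_Algebra.Polynomial"
begin

text \<open>
  As \<open>\<epsilon> \<rightarrow> 0\<close>, the pairing with \<open>\<phi>\<close> splits into the two outer regions and the strip. The outer states
  satisfy the energy balance pointwise, so the divergence theorem leaves only the front terms
  \<open>\<integral> ([\<rho> u\<^sup>3] - v [\<rho> u\<^sup>2]) \<phi> / 2 dt\<close>. The strip contributes
  \<open>\<integral> (- \<sigma> v\<^sup>2 (\<phi>\<^sub>t + v \<phi>\<^sub>r) + (n - 1) / r \<sigma> v\<^sup>3 \<phi>) / 2 dt\<close> along the front, which becomes
  \<open>\<integral> (2 v \<kappa>\<^sub>2 - v\<^sup>2 \<kappa>\<^sub>1) \<phi> / 2 dt\<close> after integration by parts and the equations for \<open>\<sigma>\<close> and \<open>\<sigma> v\<close>.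
  The sum is \<open>\<integral> D \<phi> / 2 dt\<close> with \<open>D\<close> the cubic expression in the jumps; \<open>D\<close> is continuous, so testing
  with bump functions localised at a point of the front gives its sign. The two pointwise conditions
  agree because \<open>\<kappa>\<^sub>1 (u\<^sub>0 u\<^sub>1 - v\<^sup>2) - \<kappa>\<^sub>2 (u\<^sub>0 + u\<^sub>1 - 2 v) = D\<close> identically.
\<close>

subsection \<open>Smooth bump functions\<close>

lemma Ck_SucI:
  assumes "\<And>x. (f has_derivative f' x) (at x)" "\<And>h. Ck k (\<lambda>x. f' x h)"
  shows "Ck (Suc k) f"
proof -
  have "frechet_derivative f (at x) = f' x" for x
    using frechet_derivative_at[OF assms(1)] by simp
  with assms show ?thesis by (auto intro: differentiableI)
qed

lemma Ck_SucD: "Ck (Suc k) f \<Longrightarrow> Ck k f"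
proof (induction k arbitrary: f)
  case 0
  then show ?case
    by (auto intro!: differentiable_imp_continuous_on simp: differentiable_on_def differentiable_at_withinI)
next
  case (Suc k)
  have "Ck (Suc k) (\<lambda>x. frechet_derivative f (at x) h)" for h
    using Suc.prems by (subst (asm) Ck.simps(2)) blast
  then show ?case
    using Suc.prems Suc.IH by auto
qed

lemma Ck_const: "Ck k (\<lambda>x. a)"
proof (induction k arbitrary: a)
  case (Suc k)
  show ?case by (rule Ck_SucI[of _ "\<lambda>x h. 0"]) (auto intro!: Suc)
qed simp

lemma Ck_add: "Ck k f \<Longrightarrow> Ck k g \<Longrightarrow> Ck k (\<lambda>x. f x + g x)"
proof (induction k arbitrary: f g)
  case 0
  then show ?case by (auto intro: continuous_intros)
next
  case (Suc k)
  show ?case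
    by (rule Ck_SucI[of _ "\<lambda>x h. frechet_derivative f (at x) h + frechet_derivative g (at x) h"])
       (use Suc in \<open>auto intro!: has_derivative_add simp: frechet_derivative_works[THEN iffD1]\<close>)
qed

lemma Ck_mult: "Ck k f \<Longrightarrow> Ck k g \<Longrightarrow> Ck k (\<lambda>x. f x * g x)"
proof (induction k arbitrary: f g)
  case 0
  then show ?case by (auto intro: continuous_intros)
next
  case (Suc k)
  \<comment> \<open>The product rule leaves one factor undifferentiated in each term, so the
    induction hypothesis needs the factors themselves in class \<open>k\<close>.\<close>
  have "Ck k f" "Ck k g" using Suc.prems by (blast intro: Ck_SucD)+
  show ?case
    by (rule Ck_SucI[of _ "\<lambda>x h. f x * frechet_derivative g (at x) h + frechet_derivative f (at x) h * g x"])
       (use Suc \<open>Ck k f\<close> \<open>Ck k g\<close> in \<open>auto intro!: has_derivative_mult Ck_add simp: frechet_derivative_works[THEN iffD1]\<close>)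
qed

text \<open>The classical \<open>exp (- (1 / x))\<close> cut off at 0, with a polynomial in
  \<open>1 / x\<close> as prefactor. This family is closed under differentiation, which makes
  smoothness an induction with \<open>q\<close> arbitrary.\<close>

definition flat :: "real poly \<Rightarrow> real \<Rightarrow> real" where
  "flat q x = (if x > 0 then poly q (1 / x) * exp (- (1 / x)) else 0)"

lemma poly_times_exp_tendsto_0:
  "((\<lambda>y::real. poly q y * exp (- y)) \<longlongrightarrow> 0) at_top"
proof -
  have "((\<lambda>y. \<Sum>i\<le>degree q. coeff q i * (y ^ i / exp y)) \<longlongrightarrow> (\<Sum>i\<le>degree q. coeff q i * 0)) at_top"
    by (intro tendsto_sum tendsto_mult tendsto_const tendsto_power_div_exp_0)
  then show ?thesis
    by (simp add: poly_altdef exp_minus divide_inverse sum_distrib_right mult.assoc)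
qed

lemma flat_tendsto_0: "(flat q \<longlongrightarrow> 0) (at_right 0)"
proof -
  have "((\<lambda>x. poly q (inverse x) * exp (- inverse x)) \<longlongrightarrow> 0) (at_right 0)"
    using filterlim_compose[OF poly_times_exp_tendsto_0 filterlim_inverse_at_top_right] .
  then show ?thesis
    by (rule Lim_transform_eventually)
       (auto simp: flat_def eventually_at_right_field field_simps intro!: exI[of _ 1])
qed

text \<open>For \<open>x > 0\<close> the inner derivative of \<open>1 / x\<close> produces the
  square of \<open>1 / x\<close>, encoded by \<open>monom 1 2\<close>, and the exponential
  contributes \<open>q\<close> beside \<open>- pderiv q\<close>. At 0 the exponential decay beats
  every power of \<open>1 / x\<close>.\<close>

lemma flat_has_derivative:
  "(flat q has_real_derivative flat (monom 1 2 * (q - pderiv q)) x) (at x)"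
proof -
  consider "x > 0" | "x < 0" | "x = 0" by linarith
  then show ?thesis
  proof cases
    case 1
    have "((\<lambda>x. poly q (1 / x) * exp (- (1 / x))) has_real_derivative
        flat (monom 1 2 * (q - pderiv q)) x) (at x)"
      using 1 by (auto intro!: derivative_eq_intros DERIV_chain'[OF _ poly_DERIV]
          simp: flat_def poly_monom field_simps power2_eq_square)
    then show ?thesis
      by (rule has_field_derivative_transform_within_open[of _ _ _ "{0<..}"])
         (use 1 in \<open>auto simp: flat_def\<close>)
  next
    case 2
    have "((\<lambda>x. 0) has_real_derivative flat (monom 1 2 * (q - pderiv q)) x) (at x)"
      using 2 by (auto simp: flat_def)
    then show ?thesis
      by (rule has_field_derivative_transform_within_open[of _ _ _ "{..<0}"])
         (use 2 in \<open>auto simp: flat_def\<close>)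
  next
    case 3
    have "((\<lambda>h. (flat q (0 + h) - flat q 0) / h) \<longlongrightarrow> 0) (at_right 0)"
      \<comment> \<open>Dividing by \<open>h\<close> multiplies the polynomial by its variable, so
        the right difference quotient at 0 is again a flat function.\<close>
      using flat_tendsto_0[of "[:0, 1:] * q"]
      by (rule Lim_transform_eventually)
         (auto simp: flat_def eventually_at_right_field field_simps intro!: exI[of _ 1])
    moreover have "((\<lambda>h. (flat q (0 + h) - flat q 0) / h) \<longlongrightarrow> 0) (at_left 0)"
      by (rule Lim_transform_eventually[OF tendsto_const])
         (auto simp: flat_def eventually_at_left_field field_simps intro!: exI[of _ "-1"])
    ultimately have "((\<lambda>h. (flat q (0 + h) - flat q 0) / h) \<longlongrightarrow> 0) (at 0)"
      by (simp add: filterlim_at_split)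
    then show ?thesis using 3 by (simp add: DERIV_def flat_def)
  qed
qed

text \<open>Differentiation only replaces \<open>q\<close> by another polynomial and adds the
  constant factor \<open>l h\<close>; hence the induction over \<open>k\<close> with
  \<open>q\<close> arbitrary.\<close>

lemma Ck_flat_affine:
  fixes l :: "'a::euclidean_space \<Rightarrow> real"
  assumes "bounded_linear l"
  shows "Ck k (\<lambda>x. flat q (l x + d))"
proof (induction k arbitrary: q)
  case 0
  have "continuous_on UNIV (flat q)"
    by (intro continuous_at_imp_continuous_on ballI DERIV_isCont[OF flat_has_derivative])
  moreover have "continuous_on UNIV (\<lambda>x. l x + d)"
    by (intro continuous_intros bounded_linear.continuous_on[OF assms])
  ultimately show ?case
    using continuous_on_compose2[of UNIV "flat q" UNIV "\<lambda>x. l x + d"] by simp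
next
  case (Suc k)
  have *: "((\<lambda>x. l x + d) has_derivative l) (at x)" for x
    using has_derivative_add[OF bounded_linear_imp_has_derivative[OF assms] has_derivative_const] by simp
  show ?case
  proof (rule Ck_SucI)
    show "((\<lambda>x. flat q (l x + d)) has_derivative
       (\<lambda>h. l h * flat (monom 1 2 * (q - pderiv q)) (l x + d))) (at x)" for x
      using has_derivative_compose[OF * flat_has_derivative[unfolded has_field_derivative_def]]
      by (simp add: mult.commute)
  qed (intro Ck_mult Ck_const Suc)
qed

text \<open>A product of four factors \<open>flat 1\<close>, each positive exactly on the open half
  plane bounded by one side of the box. The strict hypotheses keep the closed box, and with it the
  support, inside the open domain.\<close>

lemma ex_test_function_box:
  assumes "\<delta> > 0" "r\<^sub>0 - \<delta> > 0" "t\<^sub>0 - \<delta> > 0" "t\<^sub>0 + \<delta> < T"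
  obtains \<phi> where "test_function T \<phi>" "\<And>p. \<phi> p \<ge> 0"
    "\<And>r t. \<phi> (r, t) > 0 \<longleftrightarrow> \<bar>r - r\<^sub>0\<bar> < \<delta> \<and> \<bar>t - t\<^sub>0\<bar> < \<delta>"
proof -
  define \<phi> :: "real \<times> real \<Rightarrow> real" where
    "\<phi> = (\<lambda>p. flat 1 (fst p + (\<delta> - r\<^sub>0)) * flat 1 (- fst p + (\<delta> + r\<^sub>0)) *
             (flat 1 (snd p + (\<delta> - t\<^sub>0)) * flat 1 (- snd p + (\<delta> + t\<^sub>0))))"
  have fl: "flat 1 x \<ge> 0" "flat 1 x > 0 \<longleftrightarrow> x > 0" "flat 1 x = 0 \<longleftrightarrow> x \<le> 0" for x
    by (auto simp: flat_def)
  have mult: "x * y > 0 \<longleftrightarrow> x > 0 \<and> y > 0" if "x \<ge> 0" "y \<ge> 0" for x y :: real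
    using that by (auto simp: zero_less_mult_iff)
  have pos: "\<phi> (r, t) > 0 \<longleftrightarrow> \<bar>r - r\<^sub>0\<bar> < \<delta> \<and> \<bar>t - t\<^sub>0\<bar> < \<delta>" for r t
    unfolding \<phi>_def by (auto simp: mult fl)
  have nn: "\<phi> p \<ge> 0" for p
    unfolding \<phi>_def by (simp add: fl)
  have "Ck k \<phi>" for k
    unfolding \<phi>_def
    by (intro Ck_mult Ck_flat_affine bounded_linear_fst bounded_linear_snd bounded_linear_minus)
  moreover define B where "B = {r\<^sub>0 - \<delta>..r\<^sub>0 + \<delta>} \<times> {t\<^sub>0 - \<delta>..t\<^sub>0 + \<delta>}"
  have "{p. \<phi> p \<noteq> 0} \<subseteq> B"
    using pos nn by (fastforce simp: B_def less_le)
  moreover have "compact B" unfolding B_def by (intro compact_Times compact_Icc)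
  ultimately have "closure {p. \<phi> p \<noteq> 0} \<subseteq> B"
    by (simp add: closure_minimal compact_imp_closed)
  moreover have "B \<subseteq> {0<..} \<times> {0<..<T}" using assms by (auto simp: B_def)
  ultimately have "test_function T \<phi>"
    using \<open>compact B\<close> \<open>\<And>k. Ck k \<phi>\<close> compact_Int_closed[OF \<open>compact B\<close> closed_closure[of "{p. \<phi> p \<noteq> 0}"]]
    unfolding test_function_def by (auto simp: Int_absorb1)
  then show ?thesis using nn pos that by blast
qed

section \<open>Partial derivatives and supports of test functions\<close>

lemma has_derivative_partials:
  assumes "(f has_derivative f') (at (r, t))"
  shows "d_r f (r, t) = f' (1, 0)" "d_t f (r, t) = f' (0, 1)"
proof -
  have *: "((\<lambda>r'. f (r', t)) has_derivative (\<lambda>h. f' (h, 0))) (at r)"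
    by (rule has_derivative_compose[where g = f]) (auto intro!: derivative_eq_intros assms)
  have **: "((\<lambda>t'. f (r, t')) has_derivative (\<lambda>h. f' (0, h))) (at t)"
    by (rule has_derivative_compose[where g = f]) (auto intro!: derivative_eq_intros assms)
  have eq: "f' (h, 0) = f' (1, 0) * h" "f' (0, h) = f' (0, 1) * h" for h
    using linear_scale[OF has_derivative_linear[OF assms], of h "(1, 0)"]
      linear_scale[OF has_derivative_linear[OF assms], of h "(0, 1)"] by (simp_all add: mult.commute)
  have "(\<lambda>h. f' (h, 0)) = (*) (f' (1, 0))" "(\<lambda>h. f' (0, h)) = (*) (f' (0, 1))"
    by (rule ext, rule eq)+
  with * ** have "((\<lambda>r'. f (r', t)) has_real_derivative f' (1, 0)) (at r)"
    "((\<lambda>t'. f (r, t')) has_real_derivative f' (0, 1)) (at t)"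
    by (simp_all only: has_field_derivative_def)
  then show "d_r f (r, t) = f' (1, 0)" "d_t f (r, t) = f' (0, 1)"
    by (simp_all add: d_r_def d_t_def DERIV_imp_deriv)
qed

text \<open>Collects what the limit computation needs of \<phi>: a continuous total derivative in
  place of the partial ones, and a compact \<open>K\<close> off which everything vanishes. The
  derivative is 0 off \<open>K\<close> because the complement of the support is open.\<close>

lemma test_functionE:
  assumes "test_function T \<phi>"
  obtains \<phi>' K where
    "\<And>p. (\<phi> has_derivative \<phi>' p) (at p)" "\<And>h. continuous_on UNIV (\<lambda>p. \<phi>' p h)"
    "\<And>p. d_r \<phi> p = \<phi>' p (1, 0)" "\<And>p. d_t \<phi> p = \<phi>' p (0, 1)"
    "compact K" "K \<subseteq> {0<..} \<times> {0<..<T}" "\<And>p. p \<notin> K \<Longrightarrow> \<phi> p = 0" "\<And>p h. p \<notin> K \<Longrightarrow> \<phi>' p h = 0"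
proof
  define \<phi>' where "\<phi>' p = frechet_derivative \<phi> (at p)" for p
  define K where "K = closure {p. \<phi> p \<noteq> 0}"
  have "Ck (Suc 0) \<phi>" using assms unfolding test_function_def by blast
  then show D: "\<And>p. (\<phi> has_derivative \<phi>' p) (at p)" "\<And>h. continuous_on UNIV (\<lambda>p. \<phi>' p h)"
    unfolding \<phi>'_def by (auto simp: frechet_derivative_works)
  show "d_r \<phi> p = \<phi>' p (1, 0)" "d_t \<phi> p = \<phi>' p (0, 1)" for p
    using has_derivative_partials[of \<phi> "\<phi>' p" "fst p" "snd p"] D(1)[of p] by simp_all
  show "compact K" "K \<subseteq> {0<..} \<times> {0<..<T}" using assms by (auto simp: test_function_def K_def)
  show 0: "\<phi> p = 0" if "p \<notin> K" for p
    using that closure_subset[of "{p. \<phi> p \<noteq> 0}"] by (auto simp: K_def)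
  show "\<phi>' p h = 0" if "p \<notin> K" for p h
  proof -
    have "open (- K)" by (simp add: K_def open_Compl)
    have "(\<phi> has_derivative (\<lambda>h. 0)) (at p)"
      by (rule has_derivative_transform_within_open[OF has_derivative_const \<open>open (- K)\<close>])
         (use that 0 in simp_all)
    from has_derivative_unique[OF D(1) this] show ?thesis by simp
  qed
qed

subsection \<open>Divergence theorem beside a curve\<close>

lemma shear_measurable:
  fixes g :: "real \<Rightarrow> real"
  assumes [measurable]: "g \<in> borel_measurable borel"
  shows "(\<lambda>p. (g (snd p) + e * fst p, snd p)) \<in> borel_measurable borel"
  unfolding borel_prod[symmetric] by measurable

text \<open>Tonelli with \<open>r\<close> innermost: for fixed \<open>t\<close> the substitution is
  affine in \<open>r\<close> with factor \<open>e\<close>, and \<open>g\<close> enters only as a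
  translation.\<close>

lemma nn_integral_shear:
  fixes g :: "real \<Rightarrow> real" and f :: "real \<times> real \<Rightarrow> ennreal"
  assumes [measurable]: "g \<in> borel_measurable borel" "f \<in> borel_measurable borel" and e: "e \<noteq> 0"
  shows "(\<integral>\<^sup>+p. f p \<partial>lborel) = ennreal \<bar>e\<bar> * (\<integral>\<^sup>+p. f (g (snd p) + e * fst p, snd p) \<partial>lborel)"
proof -
  have m: "f \<in> borel_measurable (lborel \<Otimes>\<^sub>M lborel)" 
    "(\<lambda>p. f (g (snd p) + e * fst p, snd p)) \<in> borel_measurable (lborel \<Otimes>\<^sub>M lborel)"
    using measurable_compose[OF shear_measurable[OF assms(1)] assms(2)] by (simp_all add: lborel_prod)
  have "(\<integral>\<^sup>+p. f p \<partial>lborel) = (\<integral>\<^sup>+t. \<integral>\<^sup>+r. f (r, t) \<partial>lborel \<partial>lborel)"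
    using lborel_pair.nn_integral_snd[OF m(1)] by (simp add: lborel_prod)
  also have "\<dots> = (\<integral>\<^sup>+t. ennreal \<bar>e\<bar> * (\<integral>\<^sup>+y. f (g t + e * y, t) \<partial>lborel) \<partial>lborel)"
    by (intro nn_integral_cong nn_integral_real_affine e) measurable
  also have "\<dots> = ennreal \<bar>e\<bar> * (\<integral>\<^sup>+t. \<integral>\<^sup>+y. f (g t + e * y, t) \<partial>lborel \<partial>lborel)"
    by (intro nn_integral_cmult) measurable
  also have "\<dots> = ennreal \<bar>e\<bar> * (\<integral>\<^sup>+p. f (g (snd p) + e * fst p, snd p) \<partial>lborel)"
    using lborel_pair.nn_integral_snd[OF m(2)] by (simp add: lborel_prod)
  finally show ?thesis .
qed

text \<open>The nonnegative case, applied to indicators, gives an identity of measures; this carries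
  over to every real Borel function, integrable or not.\<close>

lemma integral_shear:
  fixes g :: "real \<Rightarrow> real" and f :: "real \<times> real \<Rightarrow> real"
  assumes [measurable]: "g \<in> borel_measurable borel" "f \<in> borel_measurable borel" and e: "e \<noteq> 0"
  shows "(LINT p|lborel. f p) = \<bar>e\<bar> * (LINT p|lborel. f (g (snd p) + e * fst p, snd p))"
proof -
  let ?S = "\<lambda>p. (g (snd p) + e * fst p, snd p)"
  have S[measurable]: "?S \<in> borel_measurable borel"
    by (rule shear_measurable) measurable
  have "lborel = density (distr lborel borel ?S) (\<lambda>_. ennreal \<bar>e\<bar>)"
  proof (rule measure_eqI)
    fix X :: "(real \<times> real) set" assume "X \<in> sets lborel"
    then have [measurable]: "X \<in> sets borel" by simp
    show "emeasure lborel X = emeasure (density (distr lborel borel ?S) (\<lambda>_. ennreal \<bar>e\<bar>)) X"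
      using nn_integral_shear[OF assms(1) _ e, of "indicator X"]
      by (simp add: emeasure_density nn_integral_cmult nn_integral_distr del: nn_integral_indicator)
         (simp add: nn_integral_distr)
  qed simp
  then have "(LINT p|lborel. f p) = (LINT p|density (distr lborel borel ?S) (\<lambda>_. ennreal \<bar>e\<bar>). f p)"
    by simp
  also have "\<dots> = \<bar>e\<bar> * (LINT p|lborel. f (?S p))"
    by (subst integral_density) (simp_all add: integral_distr)
  finally show ?thesis .
qed

text \<open>
  The region on the side \<open>s * (r - g t) < 0\<close> of the curve \<open>r = g t\<close> is straightened by
  \<open>(x, t) \<mapsto> (g t + s x, t)\<close>, under which the divergence of \<open>(Q, P)\<close> becomes
  \<open>\<partial>\<^sub>t P + s \<partial>\<^sub>x (Q - v P)\<close>; each term is integrated first in its own variable.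
\<close>

lemma divergence_beside_curve:
  fixes g v :: "real \<Rightarrow> real" and P Q :: "real \<times> real \<Rightarrow> real"
    and P' Q' :: "real \<times> real \<Rightarrow> real \<times> real \<Rightarrow> real" and s l u a b :: real
  defines "W \<equiv> {(r, t). l < t \<and> t < u \<and> s * (r - g t) \<le> 0}"
  assumes s: "s = 1 \<or> s = - 1"
    and g: "\<And>t. t \<in> {l<..<u} \<Longrightarrow> (g has_real_derivative v t) (at t)"
    and v: "continuous_on {l<..<u} v"
    and P: "\<And>p. p \<in> W \<Longrightarrow> (P has_derivative P' p) (at p within W)"
    and P': "\<And>h. continuous_on W (\<lambda>p. P' p h)"
    and Q: "\<And>p. p \<in> W \<Longrightarrow> (Q has_derivative Q' p) (at p within W)"
    and Q': "\<And>h. continuous_on W (\<lambda>p. Q' p h)"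
    and ab: "l < a" "a < b" "b < u"
    and K: "bounded K" "K \<subseteq> UNIV \<times> {a<..<b}"
    and 0: "\<And>p. p \<notin> K \<Longrightarrow> P p = 0" "\<And>p. p \<notin> K \<Longrightarrow> Q p = 0"
      "\<And>p h. p \<notin> K \<Longrightarrow> P' p h = 0" "\<And>p h. p \<notin> K \<Longrightarrow> Q' p h = 0"
  shows "integrable lborel (\<lambda>p. indicator {(r, t). l < t \<and> t < u \<and> s * (r - g t) < 0} p
           * (P' p (0, 1) + Q' p (1, 0)))" (is "integrable _ ?f")
    and "(LINT p|lborel. indicator {(r, t). l < t \<and> t < u \<and> s * (r - g t) < 0} p
           * (P' p (0, 1) + Q' p (1, 0))) = s * integral {a..b} (\<lambda>t. Q (g t, t) - v t * P (g t, t))"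
proof -
  define S where "S = (\<lambda>q. (g (snd q) + s * fst q, snd q))"
  have ss: "s * s = 1" "s * (s * x) = x" for x using s by auto
  have gcont: "continuous_on {l<..<u} g"
    by (intro continuous_at_imp_continuous_on ballI DERIV_isCont) (use g in blast)
  then have gab: "continuous_on {a..b} g"
    by (rule continuous_on_subset) (use ab in auto)
  obtain M1 where M1: "\<And>p. p \<in> K \<Longrightarrow> norm p \<le> M1"
    using K(1) bounded_iff by blast
  obtain M2 where "\<forall>x\<in>g ` {a..b}. norm x \<le> M2"
    using compact_imp_bounded[OF compact_continuous_image[OF gab compact_Icc]] bounded_iff by blast
  then have M2: "\<bar>g t\<bar> \<le> M2" if "t \<in> {a..b}" for t
    using that by auto
  \<comment> \<open>\<open>M\<close> exceeds the distance in \<open>r\<close> from any point of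
    \<open>K\<close> to the curve, so on the side \<open>x \<le> 0\<close> the straightened support
    lies in the box \<open>B\<close>.\<close>
  define M where "M = \<bar>M1\<bar> + \<bar>M2\<bar> + 1"
  have M: "M > 0" "\<bar>r - g t\<bar> < M" if "(r, t) \<in> K" for r t
  proof -
    have "\<bar>r\<bar> \<le> M1" using M1[OF that] norm_fst_le[of r t] by simp
    moreover have "\<bar>g t\<bar> \<le> M2" using M2 that K(2) by auto
    ultimately show "\<bar>r - g t\<bar> < M" by (simp add: M_def)
  qed (simp add: M_def)
  have "M > 0" by (simp add: M_def)
  define B where "B = cbox (- M, a) (0, b)"
  have B: "B = {- M..0} \<times> {a..b}" by (simp add: B_def cbox_Pair_eq)
  have SW: "S q \<in> W" if "q \<in> {..0} \<times> {a..b}" for q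
    using that ab by (auto simp: S_def W_def ss)
  have Scont: "continuous_on B S"
    unfolding S_def B
    by (intro continuous_intros continuous_on_compose2[OF gab]) auto
  have vB: "continuous_on B (\<lambda>q. v (snd q))"
    by (rule continuous_on_compose2[OF v]) (use ab in \<open>auto simp: B intro: continuous_intros\<close>)
  have comp: "continuous_on B (\<lambda>q. F (S q))" if "continuous_on W F" for F :: "real \<times> real \<Rightarrow> real"
    by (rule continuous_on_compose2[OF that Scont]) (use SW in \<open>auto simp: B\<close>)
  \<comment> \<open>\<open>D1\<close> is the \<open>t\<close>-derivative of \<open>P\<close>
    composed with \<open>S\<close>, and \<open>D2\<close> the \<open>x\<close>-derivative of
    \<open>Q - v P\<close> composed with \<open>S\<close>. In \<open>E\<close> the terms with
    \<open>v\<close> cancel because \<open>s * s = 1\<close>.\<close>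
  define D1 where "D1 = (\<lambda>q. P' (S q) (0, 1) + v (snd q) * P' (S q) (1, 0))"
  define D2 where "D2 = (\<lambda>q. s * (Q' (S q) (1, 0) - v (snd q) * P' (S q) (1, 0)))"
  define E where "E = (\<lambda>q. P' (S q) (0, 1) + Q' (S q) (1, 0))"
  have cD: "continuous_on B D1" "continuous_on B D2" "continuous_on B E"
    unfolding D1_def D2_def E_def by (intro continuous_intros comp P' Q' vB)+
  have E: "E q = D1 q + s * D2 q" for q
    by (simp add: E_def D1_def D2_def ss)
  have lin: "P' p (x, y) = x * P' p (1, 0) + y * P' p (0, 1)" "Q' p (x, y) = x * Q' p (1, 0) + y * Q' p (0, 1)"
    if "p \<in> W" for p x y
  proof -
    have *: "f (x, y) = x * f (1, 0) + y * f (0, 1)" if "linear f" for f :: "real \<times> real \<Rightarrow> real"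
      using linear_add[OF that, of "x *\<^sub>R (1, 0)" "y *\<^sub>R (0, 1)"] linear_scale[OF that, of x "(1, 0)"]
        linear_scale[OF that, of y "(0, 1)"] by simp
    show "P' p (x, y) = x * P' p (1, 0) + y * P' p (0, 1)" "Q' p (x, y) = x * Q' p (1, 0) + y * Q' p (0, 1)"
      using P[OF that] Q[OF that] by (auto intro!: * dest: has_derivative_linear)
  qed
  \<comment> \<open>Inner integration in \<open>t\<close>: \<open>K\<close> lies strictly between
    the times \<open>a\<close> and \<open>b\<close>, so \<open>P\<close> vanishes at both
    ends.\<close>
  have int1: "integral B D1 = 0"
  proof -
    have "integral {a..b} (\<lambda>t. D1 (x, t)) = 0" if x: "x \<in> {- M..0}" for x
    proof -
      have "((\<lambda>t. D1 (x, t)) has_integral P (S (x, b)) - P (S (x, a))) {a..b}"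
      proof (rule fundamental_theorem_of_calculus)
        fix t assume t: "t \<in> {a..b}"
        have "((\<lambda>t. S (x, t)) has_derivative (\<lambda>h. (v t * h, h))) (at t within {a..b})"
          unfolding S_def using has_field_derivative_at_within[OF g[of t]] t ab
          by (auto intro!: derivative_eq_intros simp: has_field_derivative_def)
        moreover have "(P has_derivative P' (S (x, t))) (at (S (x, t)) within (\<lambda>t. S (x, t)) ` {a..b})"
          by (rule has_derivative_subset[OF P]) (use SW x t in auto)
        ultimately have "((\<lambda>t. P (S (x, t))) has_derivative (\<lambda>h. P' (S (x, t)) (v t * h, h))) (at t within {a..b})"
          by (rule has_derivative_in_compose)
        moreover have "P' (S (x, t)) (v t * h, h) = h * D1 (x, t)" for h
          using lin(1)[of "S (x, t)" "v t * h" h] SW[of "(x, t)"] x t by (simp add: D1_def algebra_simps)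
        ultimately show "((\<lambda>t. P (S (x, t))) has_vector_derivative D1 (x, t)) (at t within {a..b})"
          by (simp add: has_vector_derivative_def)
      qed (use ab in simp)
      moreover have "P (S (x, b)) = 0" "P (S (x, a)) = 0"
        using K(2) by (auto intro!: 0 simp: S_def)
      ultimately show ?thesis by (simp add: integral_unique)
    qed
    then have "integral {- M..0} (\<lambda>x. integral {a..b} (\<lambda>t. D1 (x, t))) = integral {- M..0} (\<lambda>x. 0)"
      by (rule integral_cong)
    then show ?thesis
      using integral_prod_continuous[OF cD(1)[unfolded B_def]] by (simp add: B_def)
  qed
  \<comment> \<open>Inner integration in \<open>x\<close>: the end \<open>- M\<close> lies off
    \<open>K\<close>, and the end 0 gives the trace on the curve.\<close>
  have int2: "integral B D2 = integral {a..b} (\<lambda>t. Q (g t, t) - v t * P (g t, t))"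
  proof -
    have "integral {- M..0} (\<lambda>x. D2 (x, t)) = Q (g t, t) - v t * P (g t, t)" if t: "t \<in> {a..b}" for t
    proof -
      define H where "H = (\<lambda>x. Q (S (x, t)) - v t * P (S (x, t)))"
      have "((\<lambda>x. D2 (x, t)) has_integral H 0 - H (- M)) {- M..0}"
      proof (rule fundamental_theorem_of_calculus)
        fix x assume x: "x \<in> {- M..0}"
        have *: "((\<lambda>x. S (x, t)) has_derivative (\<lambda>h. (s * h, 0))) (at x within {- M..0})"
          unfolding S_def by (auto intro!: derivative_eq_intros)
        have im: "(\<lambda>x. S (x, t)) ` {- M..0} \<subseteq> W" using SW t by auto
        have p: "S (x, t) \<in> W" using SW x t by auto
        have "((\<lambda>x. P (S (x, t))) has_derivative (\<lambda>h. P' (S (x, t)) (s * h, 0))) (at x within {- M..0})"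
          "((\<lambda>x. Q (S (x, t))) has_derivative (\<lambda>h. Q' (S (x, t)) (s * h, 0))) (at x within {- M..0})"
          by (rule has_derivative_in_compose[OF * has_derivative_subset[OF P[OF p] im]]
                   has_derivative_in_compose[OF * has_derivative_subset[OF Q[OF p] im]])+
        then have "(H has_derivative (\<lambda>h. Q' (S (x, t)) (s * h, 0) - v t * P' (S (x, t)) (s * h, 0))) (at x within {- M..0})"
          unfolding H_def by (intro derivative_intros)
        moreover have "Q' (S (x, t)) (s * h, 0) - v t * P' (S (x, t)) (s * h, 0) = h * D2 (x, t)" for h
          using lin[OF p, of "s * h" 0] by (simp add: D2_def algebra_simps)
        ultimately show "(H has_vector_derivative D2 (x, t)) (at x within {- M..0})"
          by (simp add: has_vector_derivative_def)
      qed (use \<open>M > 0\<close> in simp)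
      moreover have "S (- M, t) \<notin> K"
        using M(2)[of "g t - s * M" t] s by (auto simp: S_def)
      then have "H (- M) = 0" by (simp add: H_def 0)
      ultimately show ?thesis by (simp add: integral_unique H_def S_def)
    qed
    then have "integral {a..b} (\<lambda>t. integral {- M..0} (\<lambda>x. D2 (x, t)))
        = integral {a..b} (\<lambda>t. Q (g t, t) - v t * P (g t, t))"
      by (rule integral_cong)
    then show ?thesis
      using integral_prod_continuous[OF cD(2)[unfolded B_def]]
        integral_swap_continuous[of "- M" a 0 b "\<lambda>x t. D2 (x, t)"] cD(2)
      by (simp add: B_def)
  qed
  \<comment> \<open>\<open>P'\<close> and \<open>Q'\<close> are continuous only on \<open>W\<close>.
    The image of \<open>B\<close> under \<open>S\<close> is a compact subset of \<open>W\<close>, so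
    the integrand on the open side is a measurable restriction of a function integrable on a compact
    set.\<close>
  define f1 where "f1 = (\<lambda>p. indicator (S ` B) p *\<^sub>R (P' p (0, 1) + Q' p (1, 0)))"
  have SB: "S ` B \<subseteq> W" using SW by (auto simp: B)
  have "compact (S ` B)"
    by (rule compact_continuous_image[OF Scont]) (simp add: B_def)
  then have f1: "integrable lborel f1"
    unfolding f1_def by (rule borel_integrable_compact)
      (intro continuous_on_subset[OF _ SB] continuous_intros P' Q')
  \<comment> \<open>\<open>g\<close> is controlled only on the open interval. Cut off outside
    \<open>{a..b}\<close> it becomes Borel on the whole line, and \<open>K\<close> never meets the
    altered times.\<close>
  define g1 where "g1 = (\<lambda>t. indicator {a..b} t *\<^sub>R g t)"
  have [measurable]: "g1 \<in> borel_measurable borel"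
    unfolding g1_def by (rule borel_measurable_continuous_on_indicator[OF _ gab]) simp
  define W1 where "W1 = {p. s * (fst p - g1 (snd p)) < 0}"
  have [measurable]: "(\<lambda>p. s * (fst p - g1 (snd p))) \<in> borel_measurable borel"
    unfolding borel_prod[symmetric] by measurable
  have "{p \<in> space borel. s * (fst p - g1 (snd p)) < 0} \<in> sets borel"
    by measurable
  then have [measurable]: "W1 \<in> sets borel"
    by (simp add: W1_def)
  have f: "?f p = indicator W1 p *\<^sub>R f1 p" for p
  proof (cases "p \<in> K")
    case True
    then obtain r t where p: "p = (r, t)" "t \<in> {a<..<b}" using K(2) by (cases p) auto
    have "p \<in> S ` B" if "s * (r - g t) < 0"
    proof (rule image_eqI)
      show "p = S (s * (r - g t), t)" using p by (simp add: S_def ss)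
      show "(s * (r - g t), t) \<in> B" using that M(2)[of r t] True p s by (auto simp: B)
    qed
    then show ?thesis using p ab by (auto simp: f1_def W1_def g1_def indicator_def)
  qed (auto simp: 0 f1_def)
  have "integrable lborel (\<lambda>p. indicator W1 p *\<^sub>R f1 p)"
    by (rule integrable_mult_indicator[OF _ f1]) simp
  then show int: "integrable lborel ?f" by (simp only: f)
  have "?f \<in> borel_measurable borel"
    using borel_measurable_integrable[OF int] by simp
  then have "integral\<^sup>L lborel ?f = \<bar>s\<bar> * (LINT q|lborel. ?f (g1 (snd q) + s * fst q, snd q))"
    by (intro integral_shear) (use s in auto)
  also have "(LINT q|lborel. ?f (g1 (snd q) + s * fst q, snd q)) = (LINT q|lborel. indicator B q *\<^sub>R E q)"
  proof (rule integral_cong_AE)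
    show "(\<lambda>q. ?f (g1 (snd q) + s * fst q, snd q)) \<in> borel_measurable lborel"
      using measurable_compose[OF shear_measurable[of g1 s] \<open>?f \<in> borel_measurable borel\<close>] by simp
    show "(\<lambda>q. indicator B q *\<^sub>R E q) \<in> borel_measurable lborel"
      using borel_measurable_continuous_on_indicator[OF _ cD(3)] by (simp add: B_def)
    \<comment> \<open>The region excludes the curve while \<open>B\<close> contains the edge
      \<open>x = 0\<close>; the difference is a null set.\<close>
    have "AE q::real \<times> real in lborel. fst q \<noteq> 0"
      using AE_lborel_inner_neq[of "(1::real, 0::real)" 0] by (simp add: Basis_prod_def inner_prod_def)
    then show "AE q in lborel. ?f (g1 (snd q) + s * fst q, snd q) = indicator B q *\<^sub>R E q"
    proof eventually_elim
      case (elim q)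
      show ?case
      proof (cases "q \<in> UNIV \<times> {a..b}")
        case False
        then have "(g1 (snd q) + s * fst q, snd q) \<notin> K" using K(2) by (cases q) auto
        with False show ?thesis by (cases q) (auto simp: 0 B indicator_def)
      next
        case True
        then have eq: "(g1 (snd q) + s * fst q, snd q) = S q" by (auto simp: g1_def S_def)
        show ?thesis
        proof (cases "fst q < - M")
          case True
          then have "S q \<notin> K" using M(2)[of "fst (S q)" "snd (S q)"] s by (auto simp: S_def)
          with True show ?thesis unfolding eq by (cases q) (auto simp: 0 B indicator_def)
        next
          case False
          then show ?thesis
            unfolding eq E_def using \<open>q \<in> UNIV \<times> {a..b}\<close> elim ab
            by (cases q) (auto simp: S_def B ss indicator_def)
        qed
      qed
    qed
  qed
  also have "\<dots> = integral B E"
    using set_borel_integral_eq_integral(2)[of B E] borel_integrable_compact[OF _ cD(3)]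
    by (simp add: set_integrable_def set_lebesgue_integral_def B_def)
  also have "integral B E = integral B D1 + s * integral B D2"
    unfolding E using cD(1,2)
    by (subst integral_add) (auto simp: B_def intro!: integrable_continuous continuous_intros)
  finally show "integral\<^sup>L lborel ?f = s * integral {a..b} (\<lambda>t. Q (g t, t) - v t * P (g t, t))"
    using int1 int2 s by auto
qed

subsection \<open>Limits of the outer regions and of the strip\<close>

text \<open>Dominated convergence with majorant \<open>norm (f p)\<close>: for each fixed
  \<open>p\<close> the condition agrees with \<open>h p < 0\<close> once \<epsilon> is small. The
  limit is taken at infinity in the inverse of \<epsilon>.\<close>

lemma tendsto_integral_sublevel:
  fixes f h :: "'a \<Rightarrow> real"
  assumes f: "integrable M f" and [measurable]: "h \<in> borel_measurable M"
  shows "((\<lambda>\<epsilon>. LINT p|M. indicator {p. h p < - \<epsilon> / 2} p * f p)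
           \<longlongrightarrow> (LINT p|M. indicator {p. h p < 0} p * f p)) (at_right 0)"
  unfolding filterlim_at_right_to_top
proof (rule integral_dominated_convergence_at_top)
  have [measurable]: "f \<in> borel_measurable M" using f by simp
  show "integrable M (\<lambda>p. norm (f p))" using f by simp
  show "(\<lambda>p. indicator {p. h p < 0} p * f p) \<in> borel_measurable M"
    "(\<lambda>p. indicator {p. h p < - inverse x / 2} p * f p) \<in> borel_measurable M" for x
    unfolding indicator_def by measurable
  show "\<forall>\<^sub>F x in at_top. AE p in M. norm (indicator {p. h p < - inverse x / 2} p * f p) \<le> norm (f p)"
    by (auto simp: indicator_def)
  show "AE p in M. ((\<lambda>x. indicator {p. h p < - inverse x / 2} p * f p)
      \<longlongrightarrow> indicator {p. h p < 0} p * f p) at_top"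
  proof (rule AE_I2)
    fix p
    have "\<forall>\<^sub>F x in at_top. (h p < - inverse x / 2) = (h p < 0)"
    proof (cases "h p < 0")
      case True
      have "((\<lambda>x::real. - inverse x / 2) \<longlongrightarrow> - 0 / 2) at_top"
        by (intro tendsto_intros tendsto_inverse_0_at_top filterlim_ident) simp
      then have "\<forall>\<^sub>F x in at_top. h p < - inverse x / 2"
        by (rule order_tendstoD(1)) (use True in simp)
      then show ?thesis by eventually_elim (use True in simp)
    next
      case False
      show ?thesis
        using eventually_gt_at_top[of "0::real"] by eventually_elim (use False in \<open>auto simp: not_less intro: order_trans[of _ 0]\<close>)
    qed
    then have "\<forall>\<^sub>F x in at_top. indicator {p. h p < - inverse x / 2} p * f p = indicator {p. h p < 0} p * f p"
      by eventually_elim (simp add: indicator_def)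
    then show "((\<lambda>x. indicator {p. h p < - inverse x / 2} p * f p)
      \<longlongrightarrow> indicator {p. h p < 0} p * f p) at_top"
      by (rule tendsto_eventually)
  qed
qed

text \<open>The substitution \<open>r = g t + \<epsilon> x\<close> turns the strip into one of width
  1, and its Jacobian cancels the factor \<open>1 / \<epsilon>\<close>. What remains is a parameter
  integral that is continuous in \<epsilon>, also at 0.\<close>

lemma strip_average_tendsto:
  fixes g :: "real \<Rightarrow> real" and N :: "real \<times> real \<Rightarrow> real"
  assumes g: "continuous_on {l<..<u} g" and N: "continuous_on UNIV N"
    and ab: "l < a" "a < b" "b < u"
    and K: "compact K" "K \<subseteq> UNIV \<times> {a<..<b}" and 0: "\<And>p. p \<notin> K \<Longrightarrow> N p = 0"
  shows "\<And>\<epsilon>. integrable lborel (\<lambda>p. indicator {(r, t). l < t \<and> t < u \<and> \<bar>r - g t\<bar> \<le> \<epsilon> / 2} p * (N p / \<epsilon>))"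
      (is "\<And>\<epsilon>. integrable _ (?f \<epsilon>)")
    and "((\<lambda>\<epsilon>. LINT p|lborel. indicator {(r, t). l < t \<and> t < u \<and> \<bar>r - g t\<bar> \<le> \<epsilon> / 2} p * (N p / \<epsilon>))
          \<longlongrightarrow> integral {a..b} (\<lambda>t. N (g t, t))) (at_right 0)"
proof -
  have gab: "continuous_on {a..b} g"
    by (rule continuous_on_subset[OF g]) (use ab in auto)
  define g1 where "g1 = (\<lambda>t. indicator {a..b} t *\<^sub>R g t)"
  have [measurable]: "g1 \<in> borel_measurable borel"
    unfolding g1_def by (rule borel_measurable_continuous_on_indicator[OF _ gab]) simp
  show int: "integrable lborel (?f \<epsilon>)" for \<epsilon>
  proof -
    have [measurable]: "(\<lambda>p. fst p - g1 (snd p)) \<in> borel_measurable borel"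
      unfolding borel_prod[symmetric] by measurable
    have "{p \<in> space borel. \<bar>fst p - g1 (snd p)\<bar> \<le> \<epsilon> / 2} \<in> sets borel"
      by measurable
    then have "{p. \<bar>fst p - g1 (snd p)\<bar> \<le> \<epsilon> / 2} \<in> sets borel"
      by simp
    moreover have "integrable lborel (\<lambda>p. indicator K p *\<^sub>R (N p / \<epsilon>))"
      unfolding divide_inverse
      by (intro borel_integrable_compact K continuous_intros continuous_on_subset[OF N]) simp
    ultimately have "integrable lborel (\<lambda>p. indicator {p. \<bar>fst p - g1 (snd p)\<bar> \<le> \<epsilon> / 2} p *\<^sub>R (indicator K p *\<^sub>R (N p / \<epsilon>)))"
      by (intro integrable_mult_indicator[where f = "\<lambda>p. indicator K p *\<^sub>R (N p / \<epsilon>)"]) simp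
    moreover have "indicator {p. \<bar>fst p - g1 (snd p)\<bar> \<le> \<epsilon> / 2} p *\<^sub>R (indicator K p *\<^sub>R (N p / \<epsilon>)) = ?f \<epsilon> p" for p
      by (cases "p \<in> K"; cases p) (use K(2) ab in \<open>auto simp: 0 g1_def indicator_def\<close>)
    ultimately show ?thesis by (simp only:)
  qed
  let ?Z = "cbox (- 1 / 2 :: real, a) (1 / 2, b)"
  have Z: "?Z = {- 1 / 2..1 / 2} \<times> {a..b}" by (simp add: cbox_Pair_eq)
  define G where "G = (\<lambda>\<epsilon> q. N (g (snd q) + \<epsilon> * fst q, snd q))"
  have G: "continuous_on (UNIV \<times> ?Z) (\<lambda>(\<epsilon>, q). G \<epsilon> q)"
    unfolding G_def split_beta
    by (intro continuous_on_compose2[OF N] continuous_intros continuous_on_compose2[OF gab])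
       (auto simp: Z)
  have GZ: "continuous_on ?Z (G \<epsilon>)" for \<epsilon>
  proof -
    have "continuous_on ?Z (\<lambda>q. (\<epsilon>, q))" by (intro continuous_intros)
    from continuous_on_compose2[OF G this] show ?thesis by auto
  qed
  have eq: "(LINT p|lborel. ?f \<epsilon> p) = integral ?Z (G \<epsilon>)" if "\<epsilon> > 0" for \<epsilon>
  proof -
    have pw: "?f \<epsilon> (g1 (snd q) + \<epsilon> * fst q, snd q) = (indicator ?Z q *\<^sub>R G \<epsilon> q) / \<epsilon>" for q
    proof (cases "snd q \<in> {a..b}")
      case False
      then have "(x, snd q) \<notin> K" for x using K(2) by auto
      with False show ?thesis by (cases q) (auto simp: 0 Z)
    next
      case True
      have "\<bar>\<epsilon> * fst q\<bar> \<le> \<epsilon> / 2 \<longleftrightarrow> \<bar>fst q\<bar> \<le> 1 / 2"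
        using that by (simp add: abs_mult)
      with True show ?thesis using ab
        by (cases q) (auto simp: Z G_def g1_def indicator_def abs_le_iff)
    qed
    have "(LINT p|lborel. ?f \<epsilon> p) = \<bar>\<epsilon>\<bar> * (LINT q|lborel. ?f \<epsilon> (g1 (snd q) + \<epsilon> * fst q, snd q))"
      by (rule integral_shear) (use int[of \<epsilon>] that in \<open>auto dest: borel_measurable_integrable\<close>)
    also have "\<dots> = (LINT q|lborel. indicator ?Z q *\<^sub>R G \<epsilon> q)"
      unfolding pw using that by simp
    also have "\<dots> = integral ?Z (G \<epsilon>)"
      using set_borel_integral_eq_integral(2)[of ?Z "G \<epsilon>"] borel_integrable_compact[OF compact_cbox GZ]
      by (simp add: set_integrable_def set_lebesgue_integral_def)
    finally show ?thesis .
  qed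
  have "continuous_on UNIV (\<lambda>\<epsilon>. integral ?Z (G \<epsilon>))"
    by (rule integral_continuous_on_param[OF G])
  then have "((\<lambda>\<epsilon>. integral ?Z (G \<epsilon>)) \<longlongrightarrow> integral ?Z (G 0)) (at 0)"
    by (simp add: continuous_on_def)
  then have "((\<lambda>\<epsilon>. integral ?Z (G \<epsilon>)) \<longlongrightarrow> integral ?Z (G 0)) (at_right 0)"
    by (rule filterlim_mono) (auto simp: at_le)
  \<comment> \<open>\<open>G 0\<close> does not depend on the first coordinate, which runs over an
    interval of length 1.\<close>
  moreover have "integral ?Z (G 0) = integral {a..b} (\<lambda>t. N (g t, t))"
    using integral_prod_continuous[OF GZ[of 0]] by (simp add: G_def)
  moreover have "\<forall>\<^sub>F \<epsilon> in at_right 0. integral ?Z (G \<epsilon>) = (LINT p|lborel. ?f \<epsilon> p)"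
    using eventually_at_right_less[of "0::real"] by eventually_elim (rule eq[symmetric])
  ultimately show "((\<lambda>\<epsilon>. LINT p|lborel. ?f \<epsilon> p) \<longlongrightarrow> integral {a..b} (\<lambda>t. N (g t, t))) (at_right 0)"
    by (simp add: Lim_transform_eventually)
qed

text \<open>A point of \<open>W\<close> lies either in \<open>U\<close>, where \<open>V\<close> and
  \<open>W\<close> agree locally, or in the open complement of \<open>K\<close>, where
  \<open>f\<close> is locally zero. In the application \<open>V\<close> is restricted to
  \<open>r > 0\<close> and \<open>W\<close> is not.\<close>

lemma has_derivative_within_zero_extension:
  fixes f :: "'a::real_normed_vector \<Rightarrow> 'b::real_normed_vector"
  assumes "p \<in> W" "closed K" "K \<subseteq> U" "open U" "V \<inter> U = W \<inter> U"
    and "p \<in> U \<Longrightarrow> (f has_derivative f') (at p within V)"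
    and "\<And>q. q \<notin> K \<Longrightarrow> f q = 0" "\<And>h. p \<notin> K \<Longrightarrow> f' h = 0"
  shows "(f has_derivative f') (at p within W)"
proof (cases "p \<in> U")
  case True
  have "at p within W = at p within V"
    by (rule at_within_nhd[OF True \<open>open U\<close>]) (use assms(5) in auto)
  with assms(6)[OF True] show ?thesis by simp
next
  case False
  then have p: "p \<in> - K" using assms(3) by auto
  have "(f has_derivative (\<lambda>h. 0)) (at p within W)"
    by (rule has_derivative_at_withinI, rule has_derivative_transform_within_open[OF has_derivative_const _ p])
       (use assms(2,7) in auto)
  moreover have "f' = (\<lambda>h. 0)" using assms(8) p by auto
  ultimately show ?thesis by simp
qed

text \<open>\<open>W\<close> is the union of two relatively open pieces: its part in
  \<open>U\<close>, where continuity comes from \<open>V\<close>, and its part off \<open>K\<close>,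
  where \<open>f\<close> is 0.\<close>

lemma continuous_on_zero_extension:
  fixes f :: "'a::topological_space \<Rightarrow> 'b::real_normed_vector"
  assumes "closed K" "K \<subseteq> U" "open U" "V \<inter> U = W \<inter> U" "continuous_on V f"
    and "\<And>q. q \<notin> K \<Longrightarrow> f q = 0"
  shows "continuous_on W f"
proof -
  have W: "W = W \<inter> U \<union> W \<inter> - K" using assms(2) by auto
  have "continuous_on (W \<inter> U) f"
    by (rule continuous_on_subset[OF assms(5)]) (use assms(4) in blast)
  moreover have "continuous_on (W \<inter> - K) f"
    by (rule continuous_on_eq[OF continuous_on_const[of _ 0]]) (simp add: assms(6))
  moreover have "openin (top_of_set W) (W \<inter> U)" "openin (top_of_set W) (W \<inter> - K)"
    using assms(1,3) by (auto intro!: openin_open_Int)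
  ultimately show ?thesis
    using continuous_on_Un_local_open[of "W \<inter> U" "W \<inter> - K" f] W by simp
qed

text \<open>The kinetic energy equation is \<open>u\<close> times the momentum equation minus \<open>u\<^sup>2 / 2\<close> times the mass equation.\<close>

lemma energy_identity:
  fixes \<rho> u \<rho>\<^sub>t \<rho>\<^sub>r u\<^sub>t u\<^sub>r k :: real
  assumes "\<rho>\<^sub>t + (\<rho> * u\<^sub>r + \<rho>\<^sub>r * u) + k * \<rho> * u = 0"
    and "(\<rho> * u\<^sub>t + \<rho>\<^sub>t * u) + (\<rho> * (2 * u * u\<^sub>r) + \<rho>\<^sub>r * u\<^sup>2) + k * \<rho> * u\<^sup>2 = 0"
  shows "1 / 2 * (\<rho>\<^sub>t * u\<^sup>2 + \<rho> * (2 * u\<^sub>t * u)) + 1 / 2 * (\<rho>\<^sub>r * u ^ 3 + \<rho> * (3 * u\<^sub>r * u\<^sup>2)) + k / 2 * \<rho> * u ^ 3 = 0"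
proof -
  have "1 / 2 * (\<rho>\<^sub>t * u\<^sup>2 + \<rho> * (2 * u\<^sub>t * u)) + 1 / 2 * (\<rho>\<^sub>r * u ^ 3 + \<rho> * (3 * u\<^sub>r * u\<^sup>2)) + k / 2 * \<rho> * u ^ 3
    = u * ((\<rho> * u\<^sub>t + \<rho>\<^sub>t * u) + (\<rho> * (2 * u * u\<^sub>r) + \<rho>\<^sub>r * u\<^sup>2) + k * \<rho> * u\<^sup>2)
      - u\<^sup>2 / 2 * (\<rho>\<^sub>t + (\<rho> * u\<^sub>r + \<rho>\<^sub>r * u) + k * \<rho> * u)"
    by (simp add: algebra_simps power2_eq_square power3_eq_cube)
  with assms show ?thesis by simp
qed

text \<open>By the energy balance the integrand \<open>F\<close> is minus the divergence of energy
  flux and density times \<phi>, so \<open>divergence_beside_curve\<close> reduces the integral over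
  the full side to the front. \<open>tendsto_integral_sublevel\<close> then lets the excluded half
  strip shrink. The sign \<open>s = 1\<close> is for the left state, \<open>s = - 1\<close> for the
  right one.\<close>

lemma outer_energy_pairing:
  fixes g v :: "real \<Rightarrow> real" and \<rho> u \<phi> :: "real \<times> real \<Rightarrow> real" and s T a b :: real
  assumes s: "s = 1 \<or> s = - 1"
    and g: "\<And>t. t \<in> {0<..<T} \<Longrightarrow> (g has_real_derivative v t) (at t)"
    and v: "continuous_on {0<..<T} v"
    and C1: "C1_on {(r, t). 0 \<le> t \<and> t < T \<and> 0 < r \<and> s * (r - g t) \<le> 0} \<rho>"
      "C1_on {(r, t). 0 \<le> t \<and> t < T \<and> 0 < r \<and> s * (r - g t) \<le> 0} u"
    and sys: "solves_system n {(r, t). 0 < t \<and> t < T \<and> 0 < r \<and> s * (r - g t) < 0} \<rho> u"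
    and \<phi>: "\<And>p. (\<phi> has_derivative \<phi>' p) (at p)" "\<And>h. continuous_on UNIV (\<lambda>p. \<phi>' p h)"
    and K: "compact K" "K \<subseteq> {0<..} \<times> {a<..<b}"
    and 0: "\<And>p. p \<notin> K \<Longrightarrow> \<phi> p = 0" "\<And>p h. p \<notin> K \<Longrightarrow> \<phi>' p h = 0"
    and ab: "0 < a" "a < b" "b < T"
  defines "F \<equiv> \<lambda>p. - (1 / 2 * \<rho> p * (u p)\<^sup>2) * \<phi>' p (0, 1) - 1 / 2 * \<rho> p * (u p) ^ 3 * \<phi>' p (1, 0)
      + (real n - 1) / (2 * fst p) * \<rho> p * (u p) ^ 3 * \<phi> p"
  shows "\<And>\<epsilon>. \<epsilon> \<ge> 0 \<Longrightarrow> integrable lborel (\<lambda>p. indicator {(r, t). 0 < t \<and> t < T \<and> s * (r - g t) < - \<epsilon> / 2} p * F p)"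
    and "((\<lambda>\<epsilon>. LINT p|lborel. indicator {(r, t). 0 < t \<and> t < T \<and> s * (r - g t) < - \<epsilon> / 2} p * F p)
       \<longlongrightarrow> s * integral {a..b} (\<lambda>t. (v t * (1 / 2 * \<rho> (g t, t) * (u (g t, t))\<^sup>2)
              - 1 / 2 * \<rho> (g t, t) * (u (g t, t)) ^ 3) * \<phi> (g t, t))) (at_right 0)"
proof -
  define V where "V = {(r, t). 0 \<le> t \<and> t < T \<and> 0 < r \<and> s * (r - g t) \<le> 0}"
  \<comment> \<open>This is the whole side of the curve, as the divergence theorem asks; the points
    added to those of \<open>V\<close> have \<open>r \<le> 0\<close> and lie off
    \<open>K\<close>.\<close>
  define W where "W = {(r, t). 0 < t \<and> t < T \<and> s * (r - g t) \<le> 0}"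
  define Wo where "Wo = {(r, t). 0 < t \<and> t < T \<and> s * (r - g t) < 0}"
  define U where "U = {0::real<..} \<times> {0<..<T}"
  have U: "open U" "K \<subseteq> U" "V \<inter> U = W \<inter> U" using K(2) ab by (auto simp: U_def V_def W_def open_Times)
  have "closed K" using K(1) by (rule compact_imp_closed)
  obtain \<rho>' where \<rho>: "\<And>p. p \<in> V \<Longrightarrow> (\<rho> has_derivative \<rho>' p) (at p within V)" "\<And>h. continuous_on V (\<lambda>p. \<rho>' p h)"
    using C1(1) unfolding C1_on_def V_def[symmetric] by blast
  obtain u' where u: "\<And>p. p \<in> V \<Longrightarrow> (u has_derivative u' p) (at p within V)" "\<And>h. continuous_on V (\<lambda>p. u' p h)"
    using C1(2) unfolding C1_on_def V_def[symmetric] by blast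
  have cont: "continuous_on V \<rho>" "continuous_on V u"
    using \<rho>(1) u(1) has_derivative_continuous_on by blast+
  have \<phi>c: "continuous_on V \<phi>"
    by (rule has_derivative_continuous_on) (use \<phi>(1) has_derivative_at_withinI in blast)
  have \<phi>'c: "continuous_on V (\<lambda>p. \<phi>' p h)" for h
    by (rule continuous_on_subset[OF \<phi>(2)]) simp
  \<comment> \<open>\<open>m 2\<close> is the kinetic energy density and \<open>m 3\<close> its
    flux.\<close>
  define m where "m k = (\<lambda>p. 1 / 2 * \<rho> p * u p ^ k)" for k
  define m' where "m' k = (\<lambda>p h. 1 / 2 * (\<rho>' p h * u p ^ k + \<rho> p * (of_nat k * u' p h * u p ^ (k - 1))))" for k
  have m: "(m k has_derivative m' k p) (at p within V)" if "p \<in> V" for k p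
    unfolding m_def m'_def using \<rho>(1)[OF that] u(1)[OF that]
    by (auto intro!: derivative_eq_intros simp: algebra_simps)
  have mc: "continuous_on V (m k)" "continuous_on V (\<lambda>p. m' k p h)" for k h
    unfolding m_def m'_def by (intro continuous_intros cont \<rho>(2) u(2))+
  define P where "P k = (\<lambda>p. m k p * \<phi> p)" for k
  define P' where "P' k = (\<lambda>p h. m k p * \<phi>' p h + m' k p h * \<phi> p)" for k
  have P: "(P k has_derivative P' k p) (at p within W)" if "p \<in> W" for k p
  proof (rule has_derivative_within_zero_extension[OF that \<open>closed K\<close> U(2,1,3)])
    assume "p \<in> U"
    with that U(3) have "p \<in> V" by auto
    then show "(P k has_derivative P' k p) (at p within V)"
      unfolding P_def P'_def by (intro has_derivative_mult m has_derivative_at_withinI[OF \<phi>(1)])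
  qed (simp_all add: P_def P'_def 0)
  have P'c: "continuous_on W (\<lambda>p. P' k p h)" for k h
    by (rule continuous_on_zero_extension[OF \<open>closed K\<close> U(2,1,3)])
       (auto simp: P'_def 0 intro!: continuous_intros mc \<phi>c \<phi>'c)
  have energy: "m' 2 p (0, 1) + m' 3 p (1, 0) + (real n - 1) / (2 * fst p) * \<rho> p * u p ^ 3 = 0"
    if p: "p \<in> Wo \<inter> U" for p
  proof -
    obtain r t where rt: "p = (r, t)" by (cases p)
    have gc: "continuous_on {0<..<T} g"
      by (intro continuous_at_imp_continuous_on ballI DERIV_isCont) (use g in blast)
    \<comment> \<open>Openness of \<open>Wo \<inter> U\<close> turns derivatives within
      \<open>V\<close> into full derivatives there, so \<open>\<rho>'\<close> and \<open>u'\<close>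
      deliver the classical partial derivatives in \<open>solves_system\<close>.\<close>
    have "continuous_on U (\<lambda>p. s * (fst p - g (snd p)))"
      by (intro continuous_intros continuous_on_compose2[OF gc]) (auto simp: U_def)
    then have "open (U \<inter> (\<lambda>p. s * (fst p - g (snd p))) -` {..<0})"
      by (rule continuous_open_preimage) (auto simp: U)
    also have "U \<inter> (\<lambda>p. s * (fst p - g (snd p))) -` {..<0} = Wo \<inter> U"
      by (auto simp: Wo_def U_def)
    finally have "open (Wo \<inter> U)" .
    moreover have "Wo \<inter> U \<subseteq> V" by (auto simp: Wo_def U_def V_def)
    ultimately have at: "at p within V = at p" "p \<in> V"
      using p by (blast intro: at_within_open_subset)+
    have d: "(\<rho> has_derivative \<rho>' p) (at p)" "(u has_derivative u' p) (at p)"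
      using \<rho>(1)[OF at(2)] u(1)[OF at(2)] by (simp_all only: at(1))
    have d1: "((\<lambda>p. \<rho> p * u p) has_derivative (\<lambda>h. \<rho> p * u' p h + \<rho>' p h * u p)) (at p)"
      using d by (rule has_derivative_mult)
    have d2: "((\<lambda>p. \<rho> p * (u p)\<^sup>2) has_derivative (\<lambda>h. \<rho> p * (2 * u p * u' p h) + \<rho>' p h * (u p)\<^sup>2)) (at p)"
      using d by (auto intro!: derivative_eq_intros simp: algebra_simps)
    have "r > 0" using p rt by (auto simp: U_def)
    have "p \<in> {(r, t). 0 < t \<and> t < T \<and> 0 < r \<and> s * (r - g t) < 0}"
      using p by (auto simp: Wo_def U_def)
    with sys have "d_t \<rho> p + d_r (\<lambda>p. \<rho> p * u p) p + (real n - 1) / r * \<rho> p * u p = 0 \<and>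
        d_t (\<lambda>p. \<rho> p * u p) p + d_r (\<lambda>p. \<rho> p * (u p)\<^sup>2) p + (real n - 1) / r * \<rho> p * (u p)\<^sup>2 = 0"
      unfolding solves_system_def rt by blast
    then have eqs: "\<rho>' p (0, 1) + (\<rho> p * u' p (1, 0) + \<rho>' p (1, 0) * u p) + (real n - 1) / r * \<rho> p * u p = 0"
      "(\<rho> p * u' p (0, 1) + \<rho>' p (0, 1) * u p) + (\<rho> p * (2 * u p * u' p (1, 0)) + \<rho>' p (1, 0) * (u p)\<^sup>2)
        + (real n - 1) / r * \<rho> p * (u p)\<^sup>2 = 0"
      using has_derivative_partials d d1 d2 unfolding rt by simp_all
    from energy_identity[OF eqs] show ?thesis
      by (simp add: m'_def rt)
  qed
  have F: "F p = - (P' 2 p (0, 1) + P' 3 p (1, 0))" if "p \<in> Wo" for p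
  proof (cases "p \<in> U")
    case True
    have "F p = - (m 2 p * \<phi>' p (0, 1)) - m 3 p * \<phi>' p (1, 0) + (real n - 1) / (2 * fst p) * \<rho> p * u p ^ 3 * \<phi> p"
      by (simp add: F_def m_def)
    also have "(real n - 1) / (2 * fst p) * \<rho> p * u p ^ 3 = - (m' 2 p (0, 1) + m' 3 p (1, 0))"
      using energy[of p] that True by simp
    finally show ?thesis by (simp add: P'_def algebra_simps)
  next
    case False
    then have "p \<notin> K" using U by auto
    then show ?thesis by (simp add: F_def P'_def 0)
  qed
  have ind: "indicator Wo p * F p = - (indicator Wo p * (P' 2 p (0, 1) + P' 3 p (1, 0)))" for p
    using F[of p] by (simp add: indicator_def)
  have div: "integrable lborel (\<lambda>p. indicator Wo p * (P' 2 p (0, 1) + P' 3 p (1, 0)))"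
    "(LINT p|lborel. indicator Wo p * (P' 2 p (0, 1) + P' 3 p (1, 0))) =
      s * integral {a..b} (\<lambda>t. P 3 (g t, t) - v t * P 2 (g t, t))"
    unfolding Wo_def
    by (rule divergence_beside_curve[OF s g v P[unfolded W_def] P'c[unfolded W_def] P[unfolded W_def] P'c[unfolded W_def],
          of a b K]; use ab K compact_imp_bounded[OF K(1)] in \<open>auto simp: P_def P'_def 0\<close>)+
  have int0: "integrable lborel (\<lambda>p. indicator Wo p * F p)"
    using div(1) unfolding ind by simp
  have int0_eq: "(LINT p|lborel. indicator Wo p * F p) =
      s * integral {a..b} (\<lambda>t. (v t * m 2 (g t, t) - m 3 (g t, t)) * \<phi> (g t, t))"
  proof -
    have "(\<lambda>t. (v t * m 2 (g t, t) - m 3 (g t, t)) * \<phi> (g t, t)) = (\<lambda>t. - (P 3 (g t, t) - v t * P 2 (g t, t)))"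
      by (auto simp: P_def algebra_simps)
    then have "integral {a..b} (\<lambda>t. (v t * m 2 (g t, t) - m 3 (g t, t)) * \<phi> (g t, t))
        = - integral {a..b} (\<lambda>t. P 3 (g t, t) - v t * P 2 (g t, t))"
      by (simp only: integral_neg)
    then show ?thesis
      using div(2) unfolding ind by simp
  qed
  define g1 where "g1 = (\<lambda>t. indicator {a..b} t *\<^sub>R g t)"
  have "continuous_on {a..b} g"
    by (intro continuous_at_imp_continuous_on ballI DERIV_isCont[OF g]) (use ab in auto)
  then have [measurable]: "g1 \<in> borel_measurable borel"
    unfolding g1_def by (intro borel_measurable_continuous_on_indicator) simp_all
  define h where "h = (\<lambda>p. s * (fst p - g1 (snd p)))"
  have [measurable]: "h \<in> borel_measurable borel"
    unfolding h_def borel_prod[symmetric] by measurable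
  \<comment> \<open>The shrunken side becomes a sublevel set of the globally measurable
    \<open>h\<close> within \<open>Wo\<close>. Replacing \<open>g\<close> by \<open>g1\<close>
    changes something only off \<open>K\<close>, where \<open>F\<close> vanishes.\<close>
  have *: "indicator {(r, t). 0 < t \<and> t < T \<and> s * (r - g t) < - \<epsilon> / 2} p * F p
     = indicator {p. h p < - \<epsilon> / 2} p * (indicator Wo p * F p)" if "\<epsilon> \<ge> 0" for \<epsilon> p
  proof (cases "p \<in> K")
    case True
    then show ?thesis
      using K(2) that ab by (cases p) (auto simp: h_def g1_def Wo_def indicator_def)
  qed (simp add: F_def 0)
  show "integrable lborel (\<lambda>p. indicator {(r, t). 0 < t \<and> t < T \<and> s * (r - g t) < - \<epsilon> / 2} p * F p)"
    if "\<epsilon> \<ge> 0" for \<epsilon>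
  proof -
    have "{p \<in> space borel. h p < - \<epsilon> / 2} \<in> sets borel" by measurable
    then show ?thesis
      unfolding *[OF that] using integrable_mult_indicator[of "{p. h p < - \<epsilon> / 2}" lborel, OF _ int0] by simp
  qed
  have "((\<lambda>\<epsilon>. LINT p|lborel. indicator {p. h p < - \<epsilon> / 2} p * (indicator Wo p * F p))
     \<longlongrightarrow> (LINT p|lborel. indicator {p. h p < 0} p * (indicator Wo p * F p))) (at_right 0)"
    by (rule tendsto_integral_sublevel[OF int0]) simp
  \<comment> \<open>The case \<open>\<epsilon> = 0\<close> identifies the limit with the integral
    over the full side.\<close>
  moreover have "indicator {p. h p < 0} p * (indicator Wo p * F p) = indicator Wo p * F p" for p
    using *[of 0 p] by (simp add: Wo_def)
  moreover have "\<forall>\<^sub>F \<epsilon> in at_right 0. (LINT p|lborel. indicator {p. h p < - \<epsilon> / 2} p * (indicator Wo p * F p))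
      = (LINT p|lborel. indicator {(r, t). 0 < t \<and> t < T \<and> s * (r - g t) < - \<epsilon> / 2} p * F p)"
    using eventually_at_right_less[of "0::real"] by eventually_elim (simp only: * less_imp_le)
  ultimately have "((\<lambda>\<epsilon>. LINT p|lborel. indicator {(r, t). 0 < t \<and> t < T \<and> s * (r - g t) < - \<epsilon> / 2} p * F p)
       \<longlongrightarrow> (LINT p|lborel. indicator Wo p * F p)) (at_right 0)"
    by (simp add: Lim_transform_eventually)
  then show "((\<lambda>\<epsilon>. LINT p|lborel. indicator {(r, t). 0 < t \<and> t < T \<and> s * (r - g t) < - \<epsilon> / 2} p * F p)
       \<longlongrightarrow> s * integral {a..b} (\<lambda>t. (v t * (1 / 2 * \<rho> (g t, t) * (u (g t, t))\<^sup>2)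
              - 1 / 2 * \<rho> (g t, t) * (u (g t, t)) ^ 3) * \<phi> (g t, t))) (at_right 0)"
    unfolding int0_eq m_def .
qed

subsection \<open>Shadow waves\<close>

lemma at_within_right_open_interval:
  fixes t T :: real
  assumes "0 < t" "t < T"
  shows "at t within {0..<T} = at t"
  by (rule at_within_open_subset[of _ "{0<..<T}"]) (use assms in auto)

lemma ddt_eq:
  assumes "0 < t" "t < T" "(f has_real_derivative D) (at t)"
  shows "ddt T f t = D"
  using assms unfolding ddt_def at_within_right_open_interval[OF assms(1,2)]
  by (intro vector_derivative_at) (simp add: has_real_derivative_iff_has_vector_derivative)

lemma C1_on_realE:
  assumes "C1_on {0..<T} f"
  obtains f' where "\<And>t. t \<in> {0<..<T} \<Longrightarrow> (f has_real_derivative f' t) (at t)" "continuous_on {0<..<T} f'"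
proof -
  obtain f' where f': "\<And>t. t \<in> {0..<T} \<Longrightarrow> (f has_derivative f' t) (at t within {0..<T})"
    "continuous_on {0..<T} (\<lambda>t. f' t 1)"
    using assms unfolding C1_on_def by blast
  show thesis
  proof
    fix t assume t: "t \<in> {0<..<T}"
    then have d: "(f has_derivative f' t) (at t)"
      using f'(1)[of t] at_within_right_open_interval[of t T] by simp
    have "f' t h = f' t 1 * h" for h
      using linear_scale[OF has_derivative_linear[OF d], of h 1] by (simp add: mult.commute)
    then have "f' t = (*) (f' t 1)"
      by (rule ext)
    with d show "(f has_real_derivative f' t 1) (at t)"
      by (simp only: has_field_derivative_def)
  next
    show "continuous_on {0<..<T} (\<lambda>t. f' t 1)"
      by (rule continuous_on_subset[OF f'(2)]) auto
  qed
qed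

lemma compact_subset_open_interval:
  fixes S :: "real set"
  assumes "compact S" "S \<subseteq> {0<..<T}" "0 < T"
  obtains a b where "0 < a" "a < b" "b < T" "S \<subseteq> {a<..<b}"
proof -
  \<comment> \<open>Adding \<open>T / 2\<close> makes the extrema exist even for empty
    \<open>S\<close> and forces \<open>a < b\<close> for the final endpoints.\<close>
  have c: "compact (insert (T / 2) S)" "insert (T / 2) S \<noteq> {}" using assms(1) by auto
  obtain l where l: "l \<in> insert (T / 2) S" "\<forall>x\<in>insert (T / 2) S. l \<le> x"
    using compact_attains_inf[OF c] by blast
  obtain m where m: "m \<in> insert (T / 2) S" "\<forall>x\<in>insert (T / 2) S. x \<le> m"
    using compact_attains_sup[OF c] by blast
  have "0 < l" "l \<le> T / 2" "T / 2 \<le> m" "m < T" using l m assms(2,3) by auto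
  moreover have "S \<subseteq> {l / 2<..<(m + T) / 2}"
  proof
    fix x assume "x \<in> S"
    then have "l \<le> x" "x \<le> m" using l m by auto
    with \<open>0 < l\<close> \<open>m < T\<close> show "x \<in> {l / 2<..<(m + T) / 2}" by auto
  qed
  ultimately show thesis using that[of "l / 2" "(m + T) / 2"] assms(3) by auto
qed

text \<open>The jump of \<open>\<rho> * (u - v) ^ 3\<close> with \<open>v = ddt T c t\<close>,
  expanded in powers of \<open>v\<close>: twice the jump of the kinetic energy flux in the frame
  moving with the front.\<close>

definition energy_jump ::
    "real \<Rightarrow> real \<Rightarrow> (real \<Rightarrow> real) \<Rightarrow> (real \<times> real \<Rightarrow> real) \<Rightarrow> (real \<times> real \<Rightarrow> real) \<Rightarrow>
     (real \<times> real \<Rightarrow> real) \<Rightarrow> (real \<times> real \<Rightarrow> real) \<Rightarrow> real \<Rightarrow> real" where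
  "energy_jump R T c \<rho>\<^sub>0 u\<^sub>0 \<rho>\<^sub>1 u\<^sub>1 t =
     - ((ddt T c t) ^ 3) * jump_mom R c \<rho>\<^sub>0 u\<^sub>0 \<rho>\<^sub>1 u\<^sub>1 0 t
       + 3 * (ddt T c t)\<^sup>2 * jump_mom R c \<rho>\<^sub>0 u\<^sub>0 \<rho>\<^sub>1 u\<^sub>1 1 t
       - 3 * ddt T c t * jump_mom R c \<rho>\<^sub>0 u\<^sub>0 \<rho>\<^sub>1 u\<^sub>1 2 t
       + jump_mom R c \<rho>\<^sub>0 u\<^sub>0 \<rho>\<^sub>1 u\<^sub>1 3 t"

text \<open>With \<open>w = u - ddt T c t\<close> the left side is \<open>(w\<^sub>0 + w\<^sub>1)
  [\<rho> w\<^sup>2] - w\<^sub>0 w\<^sub>1 [\<rho> w]\<close>; the mixed terms cancel and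
  \<open>[\<rho> w\<^sup>3]\<close> remains.\<close>

lemma energy_jump_eq:
  "kappa1 R T c \<rho>\<^sub>0 u\<^sub>0 \<rho>\<^sub>1 u\<^sub>1 t * (u\<^sub>0 (R + c t, t) * u\<^sub>1 (R + c t, t) - (ddt T c t)\<^sup>2)
     - kappa2 R T c \<rho>\<^sub>0 u\<^sub>0 \<rho>\<^sub>1 u\<^sub>1 t * (u\<^sub>0 (R + c t, t) + u\<^sub>1 (R + c t, t) - 2 * ddt T c t)
   = energy_jump R T c \<rho>\<^sub>0 u\<^sub>0 \<rho>\<^sub>1 u\<^sub>1 t"
  by (simp add: energy_jump_def kappa1_def kappa2_def jump_mom_def jump_def
      algebra_simps power2_eq_square power3_eq_cube)

text \<open>The two terms with \<open>\<phi>'\<close> combine to the total derivative of \<phi>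
  along the front. Hence \<open>?M - ?N\<close> is the derivative of
  \<open>1 / 2 * \<sigma> * v\<^sup>2 * \<phi>\<close>, which vanishes at both ends; integrability
  of \<open>?M\<close> follows from that of \<open>?N\<close>.\<close>

lemma front_integral_by_parts:
  fixes g v v' \<sigma> \<sigma>' :: "real \<Rightarrow> real"
  assumes ab: "a \<le> b"
    and d: "\<And>t. t \<in> {a..b} \<Longrightarrow> (g has_real_derivative v t) (at t)"
      "\<And>t. t \<in> {a..b} \<Longrightarrow> (v has_real_derivative v' t) (at t)"
      "\<And>t. t \<in> {a..b} \<Longrightarrow> (\<sigma> has_real_derivative \<sigma>' t) (at t)"
    and \<phi>: "\<And>p. (\<phi> has_derivative \<phi>' p) (at p)" "\<phi> (g a, a) = 0" "\<phi> (g b, b) = 0"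
    and N: "(\<lambda>t. - (1 / 2 * \<sigma> t * (v t)\<^sup>2) * \<phi>' (g t, t) (0, 1) - 1 / 2 * \<sigma> t * (v t) ^ 3 * \<phi>' (g t, t) (1, 0)
      + m t * \<phi> (g t, t)) integrable_on {a..b}"
  shows "integral {a..b} (\<lambda>t. - (1 / 2 * \<sigma> t * (v t)\<^sup>2) * \<phi>' (g t, t) (0, 1)
      - 1 / 2 * \<sigma> t * (v t) ^ 3 * \<phi>' (g t, t) (1, 0) + m t * \<phi> (g t, t))
    = integral {a..b} (\<lambda>t. (1 / 2 * \<sigma>' t * (v t)\<^sup>2 + \<sigma> t * v t * v' t + m t) * \<phi> (g t, t))"
    (is "integral _ ?N = integral _ ?M")
proof -
  let ?E' = "\<lambda>t. ?M t - ?N t"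
  have "(?E' has_integral 1 / 2 * \<sigma> b * (v b)\<^sup>2 * \<phi> (g b, b) - 1 / 2 * \<sigma> a * (v a)\<^sup>2 * \<phi> (g a, a)) {a..b}"
  proof (rule fundamental_theorem_of_calculus[OF ab])
    fix t assume t: "t \<in> {a..b}"
    have "((\<lambda>t. (g t, t)) has_derivative (\<lambda>h. (v t * h, h))) (at t)"
      using d(1)[OF t] by (auto intro!: derivative_eq_intros simp: has_field_derivative_def)
    from has_derivative_compose[OF this \<phi>(1)]
    have "((\<lambda>t. \<phi> (g t, t)) has_derivative (\<lambda>h. \<phi>' (g t, t) (v t * h, h))) (at t)" .
    moreover have "\<phi>' (g t, t) (v t * h, h) = (\<phi>' (g t, t) (0, 1) + v t * \<phi>' (g t, t) (1, 0)) * h" for h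
    proof -
      have l: "linear (\<phi>' (g t, t))" using \<phi>(1) by (rule has_derivative_linear)
      show ?thesis
        using linear_add[OF l, of "(v t * h) *\<^sub>R (1, 0)" "h *\<^sub>R (0, 1)"]
          linear_scale[OF l, of "v t * h" "(1, 0)"] linear_scale[OF l, of h "(0, 1)"]
        by (simp add: algebra_simps)
    qed
    ultimately have "((\<lambda>t. \<phi> (g t, t)) has_real_derivative \<phi>' (g t, t) (0, 1) + v t * \<phi>' (g t, t) (1, 0)) (at t)"
      by (simp only: has_field_derivative_def)
    then have "((\<lambda>t. 1 / 2 * \<sigma> t * (v t)\<^sup>2 * \<phi> (g t, t)) has_real_derivative ?E' t) (at t)"
      using d(2,3)[OF t]
      by (auto intro!: derivative_eq_intros simp: algebra_simps power2_eq_square power3_eq_cube)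
    then show "((\<lambda>t. 1 / 2 * \<sigma> t * (v t)\<^sup>2 * \<phi> (g t, t)) has_vector_derivative ?E' t) (at t within {a..b})"
      by (simp add: has_real_derivative_iff_has_vector_derivative has_vector_derivative_at_within)
  qed
  then have "(?E' has_integral 0) {a..b}" using \<phi> by simp
  from has_integral_add[OF integrable_integral[OF N] this]
  have "(?M has_integral integral {a..b} ?N) {a..b}" by simp
  then show ?thesis by (simp add: integral_unique)
qed

text \<open>Restates the data for times in the open interval, where one-sided derivatives are
  ordinary ones, and puts both outer regions into the signed form of
  \<open>outer_energy_pairing\<close>. On the right \<open>0 < r\<close> can be added because the
  front is positive.\<close>

lemma local_shadow_waveE:
  assumes sw: "local_shadow_wave n R T c \<sigma> v \<rho>\<^sub>0 u\<^sub>0 \<rho>\<^sub>1 u\<^sub>1"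
  obtains \<sigma>' v' where "T > 0" "\<And>t. t \<in> {0<..<T} \<Longrightarrow> R + c t > 0"
    "\<And>t. t \<in> {0<..<T} \<Longrightarrow> ((\<lambda>t. R + c t) has_real_derivative v t) (at t)"
    "\<And>t. t \<in> {0<..<T} \<Longrightarrow> (v has_real_derivative v' t) (at t)"
    "\<And>t. t \<in> {0<..<T} \<Longrightarrow> (\<sigma> has_real_derivative \<sigma>' t) (at t)"
    "\<And>t. t \<in> {0<..<T} \<Longrightarrow> ddt T c t = v t"
    "C1_on {(r, t). 0 \<le> t \<and> t < T \<and> 0 < r \<and> 1 * (r - (R + c t)) \<le> 0} \<rho>\<^sub>0"
    "C1_on {(r, t). 0 \<le> t \<and> t < T \<and> 0 < r \<and> 1 * (r - (R + c t)) \<le> 0} u\<^sub>0"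
    "C1_on {(r, t). 0 \<le> t \<and> t < T \<and> 0 < r \<and> - 1 * (r - (R + c t)) \<le> 0} \<rho>\<^sub>1"
    "C1_on {(r, t). 0 \<le> t \<and> t < T \<and> 0 < r \<and> - 1 * (r - (R + c t)) \<le> 0} u\<^sub>1"
    "solves_system n {(r, t). 0 < t \<and> t < T \<and> 0 < r \<and> 1 * (r - (R + c t)) < 0} \<rho>\<^sub>0 u\<^sub>0"
    "solves_system n {(r, t). 0 < t \<and> t < T \<and> 0 < r \<and> - 1 * (r - (R + c t)) < 0} \<rho>\<^sub>1 u\<^sub>1"
    "\<And>t. t \<in> {0<..<T} \<Longrightarrow> \<sigma>' t + (real n - 1) / (R + c t) * \<sigma> t * v t = kappa1 R T c \<rho>\<^sub>0 u\<^sub>0 \<rho>\<^sub>1 u\<^sub>1 t"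
    "\<And>t. t \<in> {0<..<T} \<Longrightarrow> \<sigma>' t * v t + \<sigma> t * v' t + (real n - 1) / (R + c t) * \<sigma> t * (v t)\<^sup>2
       = kappa2 R T c \<rho>\<^sub>0 u\<^sub>0 \<rho>\<^sub>1 u\<^sub>1 t"
proof -
  note sw' = sw[unfolded local_shadow_wave_def]
  have pos: "R + c t > 0" if "0 \<le> t" "t < T" for t using sw' that by simp
  obtain \<sigma>' where \<sigma>: "\<And>t. t \<in> {0<..<T} \<Longrightarrow> (\<sigma> has_real_derivative \<sigma>' t) (at t)"
    using C1_on_realE[of T \<sigma>] sw' by metis
  obtain v' where v: "\<And>t. t \<in> {0<..<T} \<Longrightarrow> (v has_real_derivative v' t) (at t)"
    using C1_on_realE[of T v] sw' by metis
  have c: "(c has_real_derivative v t) (at t)" if "t \<in> {0<..<T}" for t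
    using sw' that at_within_right_open_interval[of t T] by (metis atLeastLessThan_iff greaterThanLessThan_iff less_imp_le)
  have aux: "0 < r" if "0 \<le> t" "t < T" "R + c t \<le> r" for r t
    using pos[OF that(1,2)] that(3) by linarith
  have sets:
    "{(r, t). 0 \<le> t \<and> t < T \<and> 0 < r \<and> r \<le> R + c t} = {(r, t). 0 \<le> t \<and> t < T \<and> 0 < r \<and> 1 * (r - (R + c t)) \<le> 0}"
    "{(r, t). 0 \<le> t \<and> t < T \<and> r \<ge> R + c t} = {(r, t). 0 \<le> t \<and> t < T \<and> 0 < r \<and> - 1 * (r - (R + c t)) \<le> 0}"
    "{(r, t). 0 < t \<and> t < T \<and> 0 < r \<and> r < R + c t} = {(r, t). 0 < t \<and> t < T \<and> 0 < r \<and> 1 * (r - (R + c t)) < 0}"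
    "{(r, t). 0 < t \<and> t < T \<and> r > R + c t} = {(r, t). 0 < t \<and> t < T \<and> 0 < r \<and> - 1 * (r - (R + c t)) < 0}"
    by (auto intro: aux aux[OF less_imp_le _ less_imp_le])
  show thesis
  proof (rule that[of v' \<sigma>'])
    fix t assume t: "t \<in> {0<..<T}"
    show "((\<lambda>t. R + c t) has_real_derivative v t) (at t)"
      using c[OF t] by (auto intro!: derivative_eq_intros)
    show "ddt T c t = v t" using ddt_eq[OF _ _ c[OF t]] t by simp
    have "ddt T \<sigma> t = \<sigma>' t" using ddt_eq[OF _ _ \<sigma>[OF t]] t by simp
    moreover have "((\<lambda>s. \<sigma> s * v s) has_real_derivative \<sigma>' t * v t + \<sigma> t * v' t) (at t)"
      using \<sigma>[OF t] v[OF t] by (auto intro!: derivative_eq_intros)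
    then have "ddt T (\<lambda>s. \<sigma> s * v s) t = \<sigma>' t * v t + \<sigma> t * v' t"
      using ddt_eq t by simp
    moreover have "ddt T \<sigma> t + (real n - 1) / (R + c t) * \<sigma> t * v t = kappa1 R T c \<rho>\<^sub>0 u\<^sub>0 \<rho>\<^sub>1 u\<^sub>1 t"
      "ddt T (\<lambda>s. \<sigma> s * v s) t + (real n - 1) / (R + c t) * \<sigma> t * (v t)\<^sup>2 = kappa2 R T c \<rho>\<^sub>0 u\<^sub>0 \<rho>\<^sub>1 u\<^sub>1 t"
      using sw' t by simp_all
    ultimately show "\<sigma>' t + (real n - 1) / (R + c t) * \<sigma> t * v t = kappa1 R T c \<rho>\<^sub>0 u\<^sub>0 \<rho>\<^sub>1 u\<^sub>1 t"
      "\<sigma>' t * v t + \<sigma> t * v' t + (real n - 1) / (R + c t) * \<sigma> t * (v t)\<^sup>2 = kappa2 R T c \<rho>\<^sub>0 u\<^sub>0 \<rho>\<^sub>1 u\<^sub>1 t"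
      by simp_all
  qed (use sw' pos \<sigma> v in \<open>simp_all only: sets[symmetric] greaterThanLessThan_iff less_imp_le\<close>)
qed

section \<open>Continuity along the front and the limit of the energy pairing\<close>

lemma continuous_on_front:
  fixes s T :: real and g :: "real \<Rightarrow> real" and f :: "real \<times> real \<Rightarrow> real"
  assumes "C1_on {(r, t). 0 \<le> t \<and> t < T \<and> 0 < r \<and> s * (r - g t) \<le> 0} f" (is "C1_on ?V f")
    and "continuous_on {0<..<T} g" "\<And>t. t \<in> {0<..<T} \<Longrightarrow> g t > 0"
  shows "continuous_on {0<..<T} (\<lambda>t. f (g t, t))"
proof (rule continuous_on_compose2[of ?V f "{0<..<T}" "\<lambda>t. (g t, t)"])
  show "continuous_on ?V f"
    using assms(1) unfolding C1_on_def by (blast intro: has_derivative_continuous_on)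
  show "continuous_on {0<..<T} (\<lambda>t. (g t, t))"
    using assms(2) by (intro continuous_intros)
  show "(\<lambda>t. (g t, t)) ` {0<..<T} \<subseteq> ?V"
    by (rule image_subsetI) (use assms(3) in simp)
qed

lemma continuous_on_energy_jump:
  assumes "local_shadow_wave n R T c \<sigma> v \<rho>\<^sub>0 u\<^sub>0 \<rho>\<^sub>1 u\<^sub>1"
  shows "continuous_on {0<..<T} (energy_jump R T c \<rho>\<^sub>0 u\<^sub>0 \<rho>\<^sub>1 u\<^sub>1)"
  using assms
proof (rule local_shadow_waveE)
  fix \<sigma>' v'
  assume A: "\<And>t. t \<in> {0<..<T} \<Longrightarrow> R + c t > 0"
    "\<And>t. t \<in> {0<..<T} \<Longrightarrow> ((\<lambda>t. R + c t) has_real_derivative v t) (at t)"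
    "\<And>t. t \<in> {0<..<T} \<Longrightarrow> (v has_real_derivative v' t) (at t)"
    "\<And>t. t \<in> {0<..<T} \<Longrightarrow> ddt T c t = v t"
    "C1_on {(r, t). 0 \<le> t \<and> t < T \<and> 0 < r \<and> 1 * (r - (R + c t)) \<le> 0} \<rho>\<^sub>0"
    "C1_on {(r, t). 0 \<le> t \<and> t < T \<and> 0 < r \<and> 1 * (r - (R + c t)) \<le> 0} u\<^sub>0"
    "C1_on {(r, t). 0 \<le> t \<and> t < T \<and> 0 < r \<and> - 1 * (r - (R + c t)) \<le> 0} \<rho>\<^sub>1"
    "C1_on {(r, t). 0 \<le> t \<and> t < T \<and> 0 < r \<and> - 1 * (r - (R + c t)) \<le> 0} u\<^sub>1"
  have v: "continuous_on {0<..<T} v" and g: "continuous_on {0<..<T} (\<lambda>t. R + c t)"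
    by (rule DERIV_continuous_on[OF has_field_derivative_at_within], rule A(2,3), assumption)+
  note f = A(5-8)[THEN continuous_on_front, OF g A(1)]
  have "continuous_on {0<..<T} (\<lambda>t. - (v t ^ 3) * jump_mom R c \<rho>\<^sub>0 u\<^sub>0 \<rho>\<^sub>1 u\<^sub>1 0 t
       + 3 * (v t)\<^sup>2 * jump_mom R c \<rho>\<^sub>0 u\<^sub>0 \<rho>\<^sub>1 u\<^sub>1 1 t
       - 3 * v t * jump_mom R c \<rho>\<^sub>0 u\<^sub>0 \<rho>\<^sub>1 u\<^sub>1 2 t
       + jump_mom R c \<rho>\<^sub>0 u\<^sub>0 \<rho>\<^sub>1 u\<^sub>1 3 t)"
    unfolding jump_mom_def jump_def by (intro continuous_intros v f)
  then show ?thesis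
    by (rule continuous_on_eq) (simp add: energy_jump_def A(4))
qed

text \<open>Both implications of the theorem read off the sign of this limit. The times
  \<open>a\<close> and \<open>b\<close> strictly enclose the support of \<phi> in time, so that no
  boundary terms in time arise.\<close>

lemma energy_pairing_tendsto:
  assumes sw: "local_shadow_wave n R T c \<sigma> v \<rho>\<^sub>0 u\<^sub>0 \<rho>\<^sub>1 u\<^sub>1" and tf: "test_function T \<phi>"
  obtains a b where "0 < a" "a < b" "b < T" "\<forall>p. \<phi> p \<noteq> 0 \<longrightarrow> snd p \<in> {a<..<b}"
    "continuous_on {a..b} (\<lambda>t. energy_jump R T c \<rho>\<^sub>0 u\<^sub>0 \<rho>\<^sub>1 u\<^sub>1 t * \<phi> (R + c t, t))"
    "((\<lambda>\<epsilon>. energy_pairing n T (rho_sw R c \<sigma> \<rho>\<^sub>0 \<rho>\<^sub>1 \<epsilon>) (u_sw R c v u\<^sub>0 u\<^sub>1 \<epsilon>) \<phi>)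
       \<longlongrightarrow> 1 / 2 * integral {a..b} (\<lambda>t. energy_jump R T c \<rho>\<^sub>0 u\<^sub>0 \<rho>\<^sub>1 u\<^sub>1 t * \<phi> (R + c t, t))) (at_right 0)"
  using sw
proof (rule local_shadow_waveE)
  fix \<sigma>' v'
  let ?g = "\<lambda>t. R + c t"
  assume T: "T > 0" and pos: "\<And>t. t \<in> {0<..<T} \<Longrightarrow> R + c t > 0"
    and dg: "\<And>t. t \<in> {0<..<T} \<Longrightarrow> (?g has_real_derivative v t) (at t)"
    and dv: "\<And>t. t \<in> {0<..<T} \<Longrightarrow> (v has_real_derivative v' t) (at t)"
    and ds: "\<And>t. t \<in> {0<..<T} \<Longrightarrow> (\<sigma> has_real_derivative \<sigma>' t) (at t)"
    and dc: "\<And>t. t \<in> {0<..<T} \<Longrightarrow> ddt T c t = v t"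
    and C1: "C1_on {(r, t). 0 \<le> t \<and> t < T \<and> 0 < r \<and> 1 * (r - ?g t) \<le> 0} \<rho>\<^sub>0"
      "C1_on {(r, t). 0 \<le> t \<and> t < T \<and> 0 < r \<and> 1 * (r - ?g t) \<le> 0} u\<^sub>0"
      "C1_on {(r, t). 0 \<le> t \<and> t < T \<and> 0 < r \<and> - 1 * (r - ?g t) \<le> 0} \<rho>\<^sub>1"
      "C1_on {(r, t). 0 \<le> t \<and> t < T \<and> 0 < r \<and> - 1 * (r - ?g t) \<le> 0} u\<^sub>1"
    and sys: "solves_system n {(r, t). 0 < t \<and> t < T \<and> 0 < r \<and> 1 * (r - ?g t) < 0} \<rho>\<^sub>0 u\<^sub>0"
      "solves_system n {(r, t). 0 < t \<and> t < T \<and> 0 < r \<and> - 1 * (r - ?g t) < 0} \<rho>\<^sub>1 u\<^sub>1"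
    and k1: "\<And>t. t \<in> {0<..<T} \<Longrightarrow> \<sigma>' t + (real n - 1) / ?g t * \<sigma> t * v t = kappa1 R T c \<rho>\<^sub>0 u\<^sub>0 \<rho>\<^sub>1 u\<^sub>1 t"
    and k2: "\<And>t. t \<in> {0<..<T} \<Longrightarrow> \<sigma>' t * v t + \<sigma> t * v' t + (real n - 1) / ?g t * \<sigma> t * (v t)\<^sup>2
       = kappa2 R T c \<rho>\<^sub>0 u\<^sub>0 \<rho>\<^sub>1 u\<^sub>1 t"
  have vc: "continuous_on {0<..<T} v" and gc: "continuous_on {0<..<T} ?g" and sc: "continuous_on {0<..<T} \<sigma>"
    by (rule DERIV_continuous_on[OF has_field_derivative_at_within], rule dv dg ds, assumption)+
  obtain \<phi>' K where \<phi>: "\<And>p. (\<phi> has_derivative \<phi>' p) (at p)" "\<And>h. continuous_on UNIV (\<lambda>p. \<phi>' p h)"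
    and d\<phi>: "\<And>p. d_r \<phi> p = \<phi>' p (1, 0)" "\<And>p. d_t \<phi> p = \<phi>' p (0, 1)"
    and K: "compact K" "K \<subseteq> {0<..} \<times> {0<..<T}"
    and 0: "\<And>p. p \<notin> K \<Longrightarrow> \<phi> p = 0" "\<And>p h. p \<notin> K \<Longrightarrow> \<phi>' p h = 0"
    using test_functionE[OF tf] by metis
  have "compact (snd ` K)" by (rule compact_continuous_image[OF _ K(1)]) (intro continuous_intros)
  moreover have "snd ` K \<subseteq> {0<..<T}" using K(2) by auto
  ultimately obtain a b where ab: "0 < a" "a < b" "b < T" and "snd ` K \<subseteq> {a<..<b}"
    using compact_subset_open_interval[OF _ _ T] by metis
  then have Kab: "K \<subseteq> {0<..} \<times> {a<..<b}" using K(2) by fastforce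
  have sub: "{a..b} \<subseteq> {0<..<T}" using ab by auto
  have \<phi>c: "continuous_on UNIV \<phi>"
    using \<phi>(1) by (blast intro: has_derivative_continuous_on has_derivative_at_withinI)
  have \<phi>g: "continuous_on {0<..<T} (\<lambda>t. \<phi> (?g t, t))"
    by (rule continuous_on_compose2[OF \<phi>c]) (auto intro!: continuous_intros gc)
  have \<phi>'g: "continuous_on {0<..<T} (\<lambda>t. \<phi>' (?g t, t) h)" for h
    by (rule continuous_on_compose2[OF \<phi>(2)]) (auto intro!: continuous_intros gc)

  \<comment> \<open>\<open>F\<close> is the integrand of the energy pairing for a given state and
    \<open>f\<close> the front term of an outer state. The density enters linearly, so the strip
    state \<open>\<sigma> / \<epsilon>\<close>, \<open>v\<close> has integrand
    \<open>N / \<epsilon>\<close> with \<open>N\<close> independent of \<epsilon>.\<close>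
  define F where "F \<rho> u = (\<lambda>p. - (1 / 2 * \<rho> p * (u p)\<^sup>2) * \<phi>' p (0, 1) - 1 / 2 * \<rho> p * (u p) ^ 3 * \<phi>' p (1, 0)
      + (real n - 1) / (2 * fst p) * \<rho> p * (u p) ^ 3 * \<phi> p)" for \<rho> u :: "real \<times> real \<Rightarrow> real"
  define N where "N = (\<lambda>p. - (1 / 2 * \<sigma> (snd p) * (v (snd p))\<^sup>2) * \<phi>' p (0, 1)
      - 1 / 2 * \<sigma> (snd p) * (v (snd p)) ^ 3 * \<phi>' p (1, 0)
      + (real n - 1) / (2 * fst p) * \<sigma> (snd p) * (v (snd p)) ^ 3 * \<phi> p)"
  define f where "f \<rho> u = (\<lambda>t. (v t * (1 / 2 * \<rho> (?g t, t) * (u (?g t, t))\<^sup>2)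
              - 1 / 2 * \<rho> (?g t, t) * (u (?g t, t)) ^ 3) * \<phi> (?g t, t))" for \<rho> u :: "real \<times> real \<Rightarrow> real"
  have N0: "N p = 0" "F \<rho> u p = 0" if "p \<notin> K" for p \<rho> u
    using that by (simp_all add: N_def F_def 0)
  \<comment> \<open>The coefficients are known to be continuous only for \<open>r > 0\<close> and
    times in the open interval; \<phi> and \<open>\<phi>'\<close> vanish off \<open>K\<close>, so
    \<open>N\<close> extends by zero.\<close>
  have Nc: "continuous_on UNIV N"
  proof (rule continuous_on_zero_extension[OF compact_imp_closed[OF K(1)] K(2) _ _ _ N0(1)])
    show "open ({0::real<..} \<times> {0<..<T})" by (simp add: open_Times)
    have "continuous_on ({0<..} \<times> {0<..<T}) (\<lambda>p. \<sigma> (snd p))" "continuous_on ({0<..} \<times> {0<..<T}) (\<lambda>p. v (snd p))"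
      by (rule continuous_on_compose2[OF sc] continuous_on_compose2[OF vc]; force intro: continuous_intros)+
    moreover have "continuous_on ({0<..} \<times> {0<..<T}) \<phi>" "continuous_on ({0<..} \<times> {0<..<T}) (\<lambda>p. \<phi>' p h)" for h
      by (rule continuous_on_subset[OF \<phi>c subset_UNIV] continuous_on_subset[OF \<phi>(2) subset_UNIV])+
    ultimately show "continuous_on ({0<..} \<times> {0<..<T}) N"
      unfolding N_def by (intro continuous_intros) auto
  qed simp

  let ?I0 = "\<lambda>\<epsilon>. indicator {(r, t). 0 < t \<and> t < T \<and> 1 * (r - ?g t) < - \<epsilon> / 2}"
  let ?I1 = "\<lambda>\<epsilon>. indicator {(r, t). 0 < t \<and> t < T \<and> - 1 * (r - ?g t) < - \<epsilon> / 2}"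
  let ?Im = "\<lambda>\<epsilon>. indicator {(r, t). 0 < t \<and> t < T \<and> \<bar>r - ?g t\<bar> \<le> \<epsilon> / 2}"
  have one: "(1::real) = 1 \<or> (1::real) = - 1" "(- 1::real) = 1 \<or> (- 1::real) = - 1" by auto
  have out0: "\<And>\<epsilon>. \<epsilon> \<ge> 0 \<Longrightarrow> integrable lborel (\<lambda>p. ?I0 \<epsilon> p * F \<rho>\<^sub>0 u\<^sub>0 p)"
    "((\<lambda>\<epsilon>. LINT p|lborel. ?I0 \<epsilon> p * F \<rho>\<^sub>0 u\<^sub>0 p) \<longlongrightarrow> 1 * integral {a..b} (f \<rho>\<^sub>0 u\<^sub>0)) (at_right 0)"
    unfolding F_def f_def 
      by (rule outer_energy_pairing(1)[OF one(1) dg vc C1(1,2) sys(1) \<phi> K(1) Kab 0 ab], assumption+)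
        (rule outer_energy_pairing(2)[OF one(1) dg vc C1(1,2) sys(1) \<phi> K(1) Kab 0 ab], assumption+)
  have out1: "\<And>\<epsilon>. \<epsilon> \<ge> 0 \<Longrightarrow> integrable lborel (\<lambda>p. ?I1 \<epsilon> p * F \<rho>\<^sub>1 u\<^sub>1 p)"
    "((\<lambda>\<epsilon>. LINT p|lborel. ?I1 \<epsilon> p * F \<rho>\<^sub>1 u\<^sub>1 p) \<longlongrightarrow> - 1 * integral {a..b} (f \<rho>\<^sub>1 u\<^sub>1)) (at_right 0)"
    unfolding F_def f_def 
      by (rule outer_energy_pairing(1)[OF one(2) dg vc C1(3,4) sys(2) \<phi> K(1) Kab 0 ab], assumption+)
        (rule outer_energy_pairing(2)[OF one(2) dg vc C1(3,4) sys(2) \<phi> K(1) Kab 0 ab], assumption+)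
  have K_strip: "K \<subseteq> UNIV \<times> {a<..<b}" using Kab by auto
  have mid: "\<And>\<epsilon>. integrable lborel (\<lambda>p. ?Im \<epsilon> p * (N p / \<epsilon>))"
    "((\<lambda>\<epsilon>. LINT p|lborel. ?Im \<epsilon> p * (N p / \<epsilon>)) \<longlongrightarrow> integral {a..b} (\<lambda>t. N (?g t, t))) (at_right 0)"
    by (rule strip_average_tendsto(1)[OF gc Nc ab K(1) K_strip N0(1)], assumption)
      (rule strip_average_tendsto(2)[OF gc Nc ab K(1) K_strip N0(1)])

  have split: "energy_pairing n T (rho_sw R c \<sigma> \<rho>\<^sub>0 \<rho>\<^sub>1 \<epsilon>) (u_sw R c v u\<^sub>0 u\<^sub>1 \<epsilon>) \<phi>
      = (LINT p|lborel. ?I0 \<epsilon> p * F \<rho>\<^sub>0 u\<^sub>0 p) + (LINT p|lborel. ?I1 \<epsilon> p * F \<rho>\<^sub>1 u\<^sub>1 p)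
        + (LINT p|lborel. ?Im \<epsilon> p * (N p / \<epsilon>))" if "\<epsilon> > 0" for \<epsilon>
  proof -
    let ?F = "F (rho_sw R c \<sigma> \<rho>\<^sub>0 \<rho>\<^sub>1 \<epsilon>) (u_sw R c v u\<^sub>0 u\<^sub>1 \<epsilon>)"
    \<comment> \<open>Off \<open>K\<close> both sides vanish. On \<open>K\<close> exactly one of the
      three indicators is 1, the bounding curves belonging to the strip as in
      \<open>three_state\<close>.\<close>
    have pw: "indicator ({0<..} \<times> {0<..<T}) p * ?F p
        = ?I0 \<epsilon> p * F \<rho>\<^sub>0 u\<^sub>0 p + ?I1 \<epsilon> p * F \<rho>\<^sub>1 u\<^sub>1 p + ?Im \<epsilon> p * (N p / \<epsilon>)" for p
    proof (cases "p \<in> K")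
      case False
      then show ?thesis by (simp add: N0)
    next
      case True
      then obtain r t where p: "p = (r, t)" "0 < r" "0 < t" "t < T" using K(2) by (cases p) auto
      consider "r - ?g t < - \<epsilon> / 2" | "r - ?g t > \<epsilon> / 2" | "\<bar>r - ?g t\<bar> \<le> \<epsilon> / 2" by linarith
      then show ?thesis
      proof cases
        case 1
        then have "rho_sw R c \<sigma> \<rho>\<^sub>0 \<rho>\<^sub>1 \<epsilon> p = \<rho>\<^sub>0 p" "u_sw R c v u\<^sub>0 u\<^sub>1 \<epsilon> p = u\<^sub>0 p"
          by (simp_all add: rho_sw_def u_sw_def three_state_def p)
        then have "?F p = F \<rho>\<^sub>0 u\<^sub>0 p" by (simp add: F_def)
        with 1 p that show ?thesis by (simp add: indicator_def)
      next
        case 2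
        then have "rho_sw R c \<sigma> \<rho>\<^sub>0 \<rho>\<^sub>1 \<epsilon> p = \<rho>\<^sub>1 p" "u_sw R c v u\<^sub>0 u\<^sub>1 \<epsilon> p = u\<^sub>1 p"
          using that by (simp_all add: rho_sw_def u_sw_def three_state_def p)
        then have "?F p = F \<rho>\<^sub>1 u\<^sub>1 p" by (simp add: F_def)
        with 2 p that show ?thesis by (simp add: indicator_def)
      next
        case 3
        then have "\<not> r - R < c t - \<epsilon> / 2" "\<not> r - R > c t + \<epsilon> / 2" by linarith+
        then have "rho_sw R c \<sigma> \<rho>\<^sub>0 \<rho>\<^sub>1 \<epsilon> p = \<sigma> t / \<epsilon>" "u_sw R c v u\<^sub>0 u\<^sub>1 \<epsilon> p = v t"
          by (simp_all add: rho_sw_def u_sw_def three_state_def p)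
        then have "?F p = N p / \<epsilon>"
          using that by (simp add: F_def N_def p diff_divide_distrib add_divide_distrib)
        moreover have "\<not> 1 * (r - ?g t) < - \<epsilon> / 2" "\<not> - 1 * (r - ?g t) < - \<epsilon> / 2"
          using 3 unfolding abs_le_iff by auto
        ultimately show ?thesis using 3 p by (simp add: indicator_def)
      qed
    qed
    have "energy_pairing n T (rho_sw R c \<sigma> \<rho>\<^sub>0 \<rho>\<^sub>1 \<epsilon>) (u_sw R c v u\<^sub>0 u\<^sub>1 \<epsilon>) \<phi>
        = (LINT p|lborel. indicator ({0<..} \<times> {0<..<T}) p * ?F p)"
      by (simp add: energy_pairing_def balance_pairing_def set_lebesgue_integral_def d\<phi> F_def)
    also have "\<dots> = (LINT p|lborel. ?I0 \<epsilon> p * F \<rho>\<^sub>0 u\<^sub>0 p) + (LINT p|lborel. ?I1 \<epsilon> p * F \<rho>\<^sub>1 u\<^sub>1 p)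
        + (LINT p|lborel. ?Im \<epsilon> p * (N p / \<epsilon>))"
      unfolding pw
      using out0(1)[OF less_imp_le[OF that]] out1(1)[OF less_imp_le[OF that]] mid(1)[of \<epsilon>]
      by (simp only: Bochner_Integration.integral_add Bochner_Integration.integrable_add)
    finally show ?thesis .
  qed

  note front = C1[THEN continuous_on_front, OF gc pos]
  have cf0: "continuous_on {0<..<T} (f \<rho>\<^sub>0 u\<^sub>0)"
    unfolding f_def by (intro continuous_intros vc \<phi>g front(1,2))
  have cf1: "continuous_on {0<..<T} (f \<rho>\<^sub>1 u\<^sub>1)"
    unfolding f_def by (intro continuous_intros vc \<phi>g front(3,4))
  define m where "m t = (real n - 1) / (2 * ?g t) * \<sigma> t * (v t) ^ 3" for t
  define M where "M = (\<lambda>t. (1 / 2 * \<sigma>' t * (v t)\<^sup>2 + \<sigma> t * v t * v' t + m t) * \<phi> (?g t, t))"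
  have cN: "continuous_on {a..b} (\<lambda>t. N (?g t, t))"
    by (rule continuous_on_compose2[OF Nc])
       (auto intro!: continuous_intros continuous_on_subset[OF gc sub])
  have NM: "integral {a..b} (\<lambda>t. N (?g t, t)) = integral {a..b} M"
    using front_integral_by_parts[of a b ?g v v' \<sigma> \<sigma>' \<phi> \<phi>' m] ab sub dg dv ds \<phi>(1) Kab 0(1)
      integrable_continuous_interval[OF cN]
    unfolding N_def M_def m_def by fastforce
  let ?D = "\<lambda>t. energy_jump R T c \<rho>\<^sub>0 u\<^sub>0 \<rho>\<^sub>1 u\<^sub>1 t * \<phi> (?g t, t)"
  have cD: "continuous_on {a..b} ?D"
    by (intro continuous_intros continuous_on_subset[OF continuous_on_energy_jump[OF sw] sub]
        continuous_on_subset[OF \<phi>g sub])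
  have M: "M t = 1 / 2 * ?D t - f \<rho>\<^sub>0 u\<^sub>0 t + f \<rho>\<^sub>1 u\<^sub>1 t" if "t \<in> {a..b}" for t
  proof -
    have t: "t \<in> {0<..<T}" using that sub by auto
    let ?J = "\<lambda>k. jump_mom R c \<rho>\<^sub>0 u\<^sub>0 \<rho>\<^sub>1 u\<^sub>1 k t"
    define q where "q = (real n - 1) / ?g t"
    have m: "m t = q / 2 * \<sigma> t * (v t) ^ 3" by (simp add: m_def q_def)
    \<comment> \<open>The front momentum equation times \<open>v\<close> minus the front mass
      equation times \<open>v\<^sup>2 / 2\<close>: the same combination as in
      \<open>energy_identity\<close>.\<close>
    have "1 / 2 * \<sigma>' t * (v t)\<^sup>2 + \<sigma> t * v t * v' t + m t
      = v t * (\<sigma>' t * v t + \<sigma> t * v' t + (real n - 1) / ?g t * \<sigma> t * (v t)\<^sup>2)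
        - (v t)\<^sup>2 / 2 * (\<sigma>' t + (real n - 1) / ?g t * \<sigma> t * v t)"
      unfolding m q_def[symmetric] by (simp add: field_simps power2_eq_square power3_eq_cube)
    also have "\<dots> = v t * (v t * ?J 1 - ?J 2) - (v t)\<^sup>2 / 2 * (v t * ?J 0 - ?J 1)"
      unfolding k1[OF t] k2[OF t] by (simp add: kappa1_def kappa2_def dc[OF t])
    \<comment> \<open>The two terms beyond \<open>energy_jump\<close> are exactly those that the
      outer front terms \<open>f\<close> cancel.\<close>
    also have "\<dots> = 1 / 2 * energy_jump R T c \<rho>\<^sub>0 u\<^sub>0 \<rho>\<^sub>1 u\<^sub>1 t + v t / 2 * ?J 2 - 1 / 2 * ?J 3"
      by (simp add: energy_jump_def dc[OF t] field_simps power2_eq_square power3_eq_cube)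
    finally have "M t = (1 / 2 * energy_jump R T c \<rho>\<^sub>0 u\<^sub>0 \<rho>\<^sub>1 u\<^sub>1 t + v t / 2 * ?J 2 - 1 / 2 * ?J 3) * \<phi> (?g t, t)"
      by (simp only: M_def)
    then show ?thesis
      by (simp add: f_def jump_mom_def jump_def algebra_simps)
  qed
  have "1 * integral {a..b} (f \<rho>\<^sub>0 u\<^sub>0) + - 1 * integral {a..b} (f \<rho>\<^sub>1 u\<^sub>1)
      + integral {a..b} (\<lambda>t. N (?g t, t)) = 1 / 2 * integral {a..b} ?D"
  proof -
    note I = integrable_integral[OF integrable_continuous_interval]
    have "((\<lambda>t. 1 / 2 * ?D t - f \<rho>\<^sub>0 u\<^sub>0 t + f \<rho>\<^sub>1 u\<^sub>1 t) has_integral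
        1 / 2 * integral {a..b} ?D - integral {a..b} (f \<rho>\<^sub>0 u\<^sub>0) + integral {a..b} (f \<rho>\<^sub>1 u\<^sub>1)) {a..b}"
      by (intro has_integral_add has_integral_diff has_integral_mult_right I cD
          continuous_on_subset[OF cf0 sub] continuous_on_subset[OF cf1 sub])
    then have "integral {a..b} (\<lambda>t. 1 / 2 * ?D t - f \<rho>\<^sub>0 u\<^sub>0 t + f \<rho>\<^sub>1 u\<^sub>1 t) =
        1 / 2 * integral {a..b} ?D - integral {a..b} (f \<rho>\<^sub>0 u\<^sub>0) + integral {a..b} (f \<rho>\<^sub>1 u\<^sub>1)"
      by (rule integral_unique)
    moreover have "integral {a..b} M = integral {a..b} (\<lambda>t. 1 / 2 * ?D t - f \<rho>\<^sub>0 u\<^sub>0 t + f \<rho>\<^sub>1 u\<^sub>1 t)"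
      by (rule integral_cong) (rule M)
    ultimately show ?thesis by (simp add: NM)
  qed
  moreover have "((\<lambda>\<epsilon>. energy_pairing n T (rho_sw R c \<sigma> \<rho>\<^sub>0 \<rho>\<^sub>1 \<epsilon>) (u_sw R c v u\<^sub>0 u\<^sub>1 \<epsilon>) \<phi>)
      \<longlongrightarrow> 1 * integral {a..b} (f \<rho>\<^sub>0 u\<^sub>0) + - 1 * integral {a..b} (f \<rho>\<^sub>1 u\<^sub>1) + integral {a..b} (\<lambda>t. N (?g t, t))) (at_right 0)"
  proof (rule Lim_transform_eventually)
    show "((\<lambda>\<epsilon>. (LINT p|lborel. ?I0 \<epsilon> p * F \<rho>\<^sub>0 u\<^sub>0 p) + (LINT p|lborel. ?I1 \<epsilon> p * F \<rho>\<^sub>1 u\<^sub>1 p)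
        + (LINT p|lborel. ?Im \<epsilon> p * (N p / \<epsilon>)))
      \<longlongrightarrow> 1 * integral {a..b} (f \<rho>\<^sub>0 u\<^sub>0) + - 1 * integral {a..b} (f \<rho>\<^sub>1 u\<^sub>1) + integral {a..b} (\<lambda>t. N (?g t, t))) (at_right 0)"
      by (intro tendsto_add out0(2) out1(2) mid(2))
    show "\<forall>\<^sub>F \<epsilon> in at_right 0. (LINT p|lborel. ?I0 \<epsilon> p * F \<rho>\<^sub>0 u\<^sub>0 p) + (LINT p|lborel. ?I1 \<epsilon> p * F \<rho>\<^sub>1 u\<^sub>1 p)
        + (LINT p|lborel. ?Im \<epsilon> p * (N p / \<epsilon>))
      = energy_pairing n T (rho_sw R c \<sigma> \<rho>\<^sub>0 \<rho>\<^sub>1 \<epsilon>) (u_sw R c v u\<^sub>0 u\<^sub>1 \<epsilon>) \<phi>"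
      using eventually_at_right_less[of "0::real"] by eventually_elim (simp only: split)
  qed
  ultimately have "((\<lambda>\<epsilon>. energy_pairing n T (rho_sw R c \<sigma> \<rho>\<^sub>0 \<rho>\<^sub>1 \<epsilon>) (u_sw R c v u\<^sub>0 u\<^sub>1 \<epsilon>) \<phi>)
       \<longlongrightarrow> 1 / 2 * integral {a..b} ?D) (at_right 0)"
    by (simp only:)
  moreover have "\<forall>p. \<phi> p \<noteq> 0 \<longrightarrow> snd p \<in> {a<..<b}"
    using K_strip 0(1) by fastforce
  ultimately show thesis using that[OF ab] cD by blast
qed

section \<open>From the sign of the limit to the pointwise conditions\<close>

theorem proposition5p2:
  fixes n :: nat and R T :: real and c \<sigma> v :: "real \<Rightarrow> real"
    and \<rho>\<^sub>0 u\<^sub>0 \<rho>\<^sub>1 u\<^sub>1 :: "real \<times> real \<Rightarrow> real"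
  assumes "n \<ge> 1"
    and "local_shadow_wave n R T c \<sigma> v \<rho>\<^sub>0 u\<^sub>0 \<rho>\<^sub>1 u\<^sub>1"
  shows "(dissipative n R T c \<sigma> v \<rho>\<^sub>0 u\<^sub>0 \<rho>\<^sub>1 u\<^sub>1 \<longleftrightarrow>
           (\<forall>t\<in>{0<..<T}.
              kappa1 R T c \<rho>\<^sub>0 u\<^sub>0 \<rho>\<^sub>1 u\<^sub>1 t
                * (u\<^sub>0 (R + c t, t) * u\<^sub>1 (R + c t, t) - (ddt T c t)\<^sup>2)
              \<le> kappa2 R T c \<rho>\<^sub>0 u\<^sub>0 \<rho>\<^sub>1 u\<^sub>1 t
                * (u\<^sub>0 (R + c t, t) + u\<^sub>1 (R + c t, t) - 2 * ddt T c t)))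
       \<and> (\<forall>t\<in>{0<..<T}.
            (kappa1 R T c \<rho>\<^sub>0 u\<^sub>0 \<rho>\<^sub>1 u\<^sub>1 t
                * (u\<^sub>0 (R + c t, t) * u\<^sub>1 (R + c t, t) - (ddt T c t)\<^sup>2)
              \<le> kappa2 R T c \<rho>\<^sub>0 u\<^sub>0 \<rho>\<^sub>1 u\<^sub>1 t
                * (u\<^sub>0 (R + c t, t) + u\<^sub>1 (R + c t, t) - 2 * ddt T c t))
            \<longleftrightarrow>
            - ((ddt T c t) ^ 3) * jump_mom R c \<rho>\<^sub>0 u\<^sub>0 \<rho>\<^sub>1 u\<^sub>1 0 t
              + 3 * (ddt T c t)\<^sup>2 * jump_mom R c \<rho>\<^sub>0 u\<^sub>0 \<rho>\<^sub>1 u\<^sub>1 1 t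
              - 3 * ddt T c t * jump_mom R c \<rho>\<^sub>0 u\<^sub>0 \<rho>\<^sub>1 u\<^sub>1 2 t
              + jump_mom R c \<rho>\<^sub>0 u\<^sub>0 \<rho>\<^sub>1 u\<^sub>1 3 t \<le> 0)"
proof -
  let ?D = "energy_jump R T c \<rho>\<^sub>0 u\<^sub>0 \<rho>\<^sub>1 u\<^sub>1"
  have "dissipative n R T c \<sigma> v \<rho>\<^sub>0 u\<^sub>0 \<rho>\<^sub>1 u\<^sub>1 \<longleftrightarrow> (\<forall>t\<in>{0<..<T}. ?D t \<le> 0)"
  proof (intro iffI ballI)
    fix t\<^sub>0 assume diss: "dissipative n R T c \<sigma> v \<rho>\<^sub>0 u\<^sub>0 \<rho>\<^sub>1 u\<^sub>1" and t\<^sub>0: "t\<^sub>0 \<in> {0<..<T}"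
    show "?D t\<^sub>0 \<le> 0"
    proof (rule ccontr)
      assume "\<not> ?D t\<^sub>0 \<le> 0"
      have "isCont ?D t\<^sub>0"
        using continuous_on_energy_jump[OF assms(2)] t\<^sub>0 by (simp add: continuous_on_eq_continuous_at)
      then have "\<forall>\<^sub>F t in at t\<^sub>0. ?D t > 0"
        using \<open>\<not> ?D t\<^sub>0 \<le> 0\<close> by (intro order_tendstoD(1)) (auto simp: isCont_def)
      then obtain d where d: "d > 0" "\<And>t. \<lbrakk>t \<noteq> t\<^sub>0; \<bar>t - t\<^sub>0\<bar> < d\<rbrakk> \<Longrightarrow> ?D t > 0"
        unfolding eventually_at dist_real_def by blast
      have Rc: "R + c t\<^sub>0 > 0"
        using assms(2) t\<^sub>0 by (simp add: local_shadow_wave_def)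
      \<comment> \<open>Half the minimum keeps the closed box around the front point inside the
        domain and its time range inside the neighbourhood where \<open>?D\<close> is
        positive.\<close>
      define \<delta> where "\<delta> = Min {d, R + c t\<^sub>0, t\<^sub>0, T - t\<^sub>0} / 2"
      have \<delta>: "0 < \<delta>" "\<delta> < d" "\<delta> < R + c t\<^sub>0" "\<delta> < t\<^sub>0" "\<delta> < T - t\<^sub>0"
        using d(1) Rc t\<^sub>0 unfolding \<delta>_def by (simp_all add: min_def)
      obtain \<phi> where \<phi>: "test_function T \<phi>" "\<And>p. \<phi> p \<ge> 0"
        "\<And>r t. \<phi> (r, t) > 0 \<longleftrightarrow> \<bar>r - (R + c t\<^sub>0)\<bar> < \<delta> \<and> \<bar>t - t\<^sub>0\<bar> < \<delta>"
        by (rule ex_test_function_box[of \<delta> "R + c t\<^sub>0" t\<^sub>0 T]) (use \<delta> in auto)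
      obtain a b where
        ab: "0 < a" "a < b" "b < T" "\<forall>p. \<phi> p \<noteq> 0 \<longrightarrow> snd p \<in> {a<..<b}"
        and cont: "continuous_on {a..b} (\<lambda>t. ?D t * \<phi> (R + c t, t))"
        and lim: "((\<lambda>\<epsilon>. energy_pairing n T (rho_sw R c \<sigma> \<rho>\<^sub>0 \<rho>\<^sub>1 \<epsilon>) (u_sw R c v u\<^sub>0 u\<^sub>1 \<epsilon>) \<phi>)
          \<longlongrightarrow> 1 / 2 * integral {a..b} (\<lambda>t. ?D t * \<phi> (R + c t, t))) (at_right 0)"
        by (rule energy_pairing_tendsto[OF assms(2) \<phi>(1)])
      obtain L where L: "L \<le> 0" "((\<lambda>\<epsilon>. energy_pairing n T (rho_sw R c \<sigma> \<rho>\<^sub>0 \<rho>\<^sub>1 \<epsilon>) (u_sw R c v u\<^sub>0 u\<^sub>1 \<epsilon>) \<phi>)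
          \<longlongrightarrow> L) (at_right 0)"
        using diss \<phi>(1,2) unfolding dissipative_def by blast
      \<comment> \<open>Dissipativity provides some nonpositive limit; uniqueness of limits
        identifies it with the computed one.\<close>
      have "1 / 2 * integral {a..b} (\<lambda>t. ?D t * \<phi> (R + c t, t)) = L"
        by (rule tendsto_unique[OF _ lim L(2)]) simp
      with L(1) have le: "integral {a..b} (\<lambda>t. ?D t * \<phi> (R + c t, t)) \<le> 0"
        by simp
      \<comment> \<open>Outside the time range of the box the weight is 0, inside it
        \<open>?D\<close> is positive. A continuous nonnegative integrand whose integral is at most
        0 vanishes on \<open>{a..b}\<close>, contradicting positivity at
        \<open>t\<^sub>0\<close>.\<close>
      have nn: "?D t * \<phi> (R + c t, t) \<ge> 0" for t
      proof (cases "\<phi> (R + c t, t) = 0")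
        case False
        then have "\<phi> (R + c t, t) > 0" using \<phi>(2)[of "(R + c t, t)"] by simp
        then have "\<bar>t - t\<^sub>0\<bar> < \<delta>" using \<phi>(3) by simp
        then have "?D t > 0" using d(2)[of t] \<delta> \<open>\<not> ?D t\<^sub>0 \<le> 0\<close> by (cases "t = t\<^sub>0") auto
        then show ?thesis using \<phi>(2) by simp
      qed simp
      have p0: "\<phi> (R + c t\<^sub>0, t\<^sub>0) > 0" using \<phi>(3) \<delta>(1) by simp
      then have "t\<^sub>0 \<in> {a..b}" using ab(4)[rule_format, of "(R + c t\<^sub>0, t\<^sub>0)"] by simp
      moreover have "integral {a..b} (\<lambda>t. ?D t * \<phi> (R + c t, t)) = 0"
        using le integral_nonneg[OF integrable_continuous_interval[OF cont] nn] by simp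
      ultimately have "?D t\<^sub>0 * \<phi> (R + c t\<^sub>0, t\<^sub>0) = 0"
        using integral_eq_0_iff[OF cont ab(2) nn] by simp
      then show False using p0 \<open>\<not> ?D t\<^sub>0 \<le> 0\<close> by simp
    qed
  next
    assume D: "\<forall>t\<in>{0<..<T}. ?D t \<le> 0"
    show "dissipative n R T c \<sigma> v \<rho>\<^sub>0 u\<^sub>0 \<rho>\<^sub>1 u\<^sub>1"
      unfolding dissipative_def
    proof (intro allI impI, elim conjE)
      fix \<phi> assume \<phi>: "test_function T \<phi>" "\<forall>p. \<phi> p \<ge> 0"
      obtain a b where
        ab: "0 < a" "a < b" "b < T" "\<forall>p. \<phi> p \<noteq> 0 \<longrightarrow> snd p \<in> {a<..<b}"
        and cont: "continuous_on {a..b} (\<lambda>t. ?D t * \<phi> (R + c t, t))"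
        and lim: "((\<lambda>\<epsilon>. energy_pairing n T (rho_sw R c \<sigma> \<rho>\<^sub>0 \<rho>\<^sub>1 \<epsilon>) (u_sw R c v u\<^sub>0 u\<^sub>1 \<epsilon>) \<phi>)
          \<longlongrightarrow> 1 / 2 * integral {a..b} (\<lambda>t. ?D t * \<phi> (R + c t, t))) (at_right 0)"
        by (rule energy_pairing_tendsto[OF assms(2) \<phi>(1)])
      have "integral {a..b} (\<lambda>t. ?D t * \<phi> (R + c t, t)) \<le> integral {a..b} (\<lambda>t. 0)"
        by (rule integral_le[OF integrable_continuous_interval[OF cont]])
           (use D \<phi>(2) ab in \<open>auto intro!: mult_nonpos_nonneg\<close>)
      with lim show "\<exists>L\<le>0. ((\<lambda>\<epsilon>. energy_pairing n T (rho_sw R c \<sigma> \<rho>\<^sub>0 \<rho>\<^sub>1 \<epsilon>) (u_sw R c v u\<^sub>0 u\<^sub>1 \<epsilon>) \<phi>)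
          \<longlongrightarrow> L) (at_right 0)"
        by (intro exI[of _ "1 / 2 * integral {a..b} (\<lambda>t. ?D t * \<phi> (R + c t, t))"]) simp
    qed
  qed
  moreover have "kappa1 R T c \<rho>\<^sub>0 u\<^sub>0 \<rho>\<^sub>1 u\<^sub>1 t * (u\<^sub>0 (R + c t, t) * u\<^sub>1 (R + c t, t) - (ddt T c t)\<^sup>2)
      \<le> kappa2 R T c \<rho>\<^sub>0 u\<^sub>0 \<rho>\<^sub>1 u\<^sub>1 t * (u\<^sub>0 (R + c t, t) + u\<^sub>1 (R + c t, t) - 2 * ddt T c t)
      \<longleftrightarrow> ?D t \<le> 0" for t
    unfolding energy_jump_eq[symmetric] by linarith
  ultimately show ?thesis
    by (simp only: energy_jump_def[symmetric]) simp
qed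

end
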